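(* Let $\kappa$ be a partition of length at least two and size $d=|\kappa|$, let $\lambda_i$ be distinct real numbers, and let $M$ be the associated isospectral manifold, regarded as a homogeneous space for $\mathrm{SO}(d)$ acting by $R\cdot P=RPR^{\top}$, with origin the diagonal matrix $\Delta$ having eigenvalues $\lambda_i$ with multiplicity $\kappa_i$. Let $\mathfrak m\subset\mathfrak{so}(d)$ be the subspace of skew-symmetric matrices whose diagonal blocks, with respect to the block decomposition associated to $\kappa$, are zero. The space $\mathfrak m$ is a reductive structure. It further induces (i) a flat connection if and only if $\kappa=(1,1,\ldots,1)$, in which case $M$ is a principal homogeneous space for $\mathrm{SO}(d)$; (ii) a symmetric connection if and only if $\kappa=(k,d-k)$ (i.e. $\kappa$ has length two), in which case $M$ is isomorphic to a Grassmannian. The corresponding connection is given explicitly by $$\langle\omega,\delta P\rangle_P=\frac{1}{(\Delta\lambda)^2}\,(\delta P\,P-P\,\delta P),$$ where $\Delta\lambda$ is the difference between the two eigenvalues.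
   Context: A partition is a non-increasing, eventually zero function $\kappa\colon\mathbf N\to\mathbf N$; its size is $|\kappa|=\sum_i\kappa_i$ and its length is the number of its nonzero elements. Matrices of size $|\kappa|$ are written in blocks, block $(i,j)$ having size $\kappa_i\times\kappa_j$. The isospectral manifold associated to $\kappa$ and distinct real $\lambda_i$ is the set of real symmetric $|\kappa|\times|\kappa|$ matrices having eigenvalue $\lambda_i$ with multiplicity $\kappa_i$. $\mathrm{SO}(|\kappa|)$ acts on it transitively by $R\cdot P=RPR^{\top}$, and the isotropy group $H$ at $\Delta$ consists of the block diagonal matrices with diagonal blocks in $\mathrm O(\kappa_i)$ and total determinant one. The Grassmannian of $k$-dimensional subspaces of $\mathbf R^d$ is viewed as the $\mathrm{SO}(d)$-manifold of orthogonal projectors of rank $k$. For a Lie group $G$ with Lie algebra $\mathfrak g$ acting smoothly and transitively on $M$ (infinitesimal action $\xi\cdot x\in T_xM$, tangent map $Tg$ of $x\mapsto g\cdot x$, adjoint action $g\cdot\xi=g\xi g^{-1}$), with origin $o\in M$, isotropy group $H$ of $o$ with Lie algebra $\mathfrak h$: - a connection is a $\mathfrak g$-valued one-form $\omega\in\Omega^1(M,\mathfrak g)$ such that $\langle\omega,f\rangle_x\cdot x=f$ for all $x\in M$, $f\in T_xM$, and $\langle\omega,Tg\,f\rangle_{g\cdot x}=g\cdot\langle\omega,f\rangle_x$ for all $g\in G$; - a reductive structure is a subspace $\mathfrak m\subset\mathfrak g$ with $\mathfrak g=\mathfrak h\oplus\mathfrak m$ and $H\cdot\mathfrak m\subset\mathfrak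 m$; it induces the unique connection $\omega$ with $\omega(T_oM)=\mathfrak m$; - the connection is symmetric if $[\mathfrak m,\mathfrak m]\subset\mathfrak h$, and flat if $[\mathfrak m,\mathfrak m]\subset\mathfrak m$; - $M$ is a principal homogeneous space for $G$ if the isotropy group is trivial.
   Formalization: For κ=(1,…,1) the isotropy group is never trivial (e.g. −I fixes Δ when d=2), so "principal homogeneous space" is replaced by: all isotropy groups are discrete, and that at Δ is exactly the group of diagonal ±1 matrices of determinant one. *)

theory Defs
  imports "HOL-Analysis.Analysis"
begin

section \<open>Smooth maps and tangent vectors of subsets of Euclidean space\<close>

text \<open>\<open>Ck_on n U f\<close>: all iterated directional derivatives of \<open>f\<close> of order less than \<open>n\<close> are
  differentiable on \<open>U\<close>, and those of order \<open>n\<close> are continuous. Meant for open \<open>U\<close>.\<close>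

primrec Ck_on :: "nat \<Rightarrow> 'a::euclidean_space set \<Rightarrow> ('a \<Rightarrow> 'b::euclidean_space) \<Rightarrow> bool" where
  "Ck_on 0 U f \<longleftrightarrow> continuous_on U f"
| "Ck_on (Suc n) U f \<longleftrightarrow> (\<forall>x\<in>U. f differentiable (at x)) \<and>
     (\<forall>v. Ck_on n U (\<lambda>x. frechet_derivative f (at x) v))"

text \<open>Smoothness on an arbitrary subset: local existence of smooth extensions to the ambient space.\<close>

definition smooth_map_on :: "'a::euclidean_space set \<Rightarrow> ('a \<Rightarrow> 'b::euclidean_space) \<Rightarrow> bool" where
  "smooth_map_on S f \<longleftrightarrow>
     (\<forall>x\<in>S. \<exists>U F. open U \<and> x \<in> U \<and> (\<forall>n. Ck_on n U F) \<and> (\<forall>y\<in>S \<inter> U. F y = f y))"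

text \<open>Velocities of curves in \<open>S\<close> through \<open>x\<close>; for an embedded submanifold \<open>S\<close> this is the usual
  tangent space (differentiability of the curve at the base point alone is enough).\<close>

definition tangent_space :: "'a::euclidean_space set \<Rightarrow> 'a \<Rightarrow> 'a set" where
  "tangent_space S x =
     {v. \<exists>\<gamma>::real \<Rightarrow> 'a. \<gamma> 0 = x \<and> (\<forall>t. \<gamma> t \<in> S) \<and> (\<gamma> has_vector_derivative v) (at 0)}"

definition tangent_bundle :: "'a::euclidean_space set \<Rightarrow> ('a \<times> 'a) set" where
  "tangent_bundle S = {(x, v). x \<in> S \<and> v \<in> tangent_space S x}"


section \<open>Homogeneous spaces of matrix Lie groups\<close>

definition matrix_group :: "(real^'n^'n) set \<Rightarrow> bool" where
  "matrix_group G \<longleftrightarrow> mat 1 \<in> G \<and> (\<forall>g\<in>G. invertible g \<and> matrix_inv g \<in> G) \<and>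
     (\<forall>g\<in>G. \<forall>h\<in>G. g ** h \<in> G)"

definition lie_algebra :: "(real^'n^'n) set \<Rightarrow> (real^'n^'n) set" where
  "lie_algebra G = tangent_space G (mat 1)"

definition lie_bracket :: "real^'n^'n \<Rightarrow> real^'n^'n \<Rightarrow> real^'n^'n" where
  "lie_bracket \<xi> \<eta> = \<xi> ** \<eta> - \<eta> ** \<xi>"

definition Ad :: "real^'n^'n \<Rightarrow> real^'n^'n \<Rightarrow> real^'n^'n" where
  "Ad g \<xi> = g ** \<xi> ** matrix_inv g"

text \<open>The group \<open>G\<close> is a set of matrices, the manifold \<open>M\<close> a subset of a Euclidean space, and the
  action a function \<open>act\<close> which is also defined off \<open>G\<close> and \<open>M\<close>, so that its derivatives may be
  taken in the ambient spaces. For compact \<open>G\<close> an orbit is automatically an embedded submanifold;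
  this is why being a submanifold does not occur below.\<close>

definition homogeneous_space ::
  "(real^'n^'n) set \<Rightarrow> (real^'n^'n \<Rightarrow> 'v \<Rightarrow> 'v) \<Rightarrow> 'v::euclidean_space set \<Rightarrow> bool" where
  "homogeneous_space G act M \<longleftrightarrow>
     matrix_group G \<and> compact G \<and> M \<noteq> {} \<and>
     (\<forall>g\<in>G. \<forall>x\<in>M. act g x \<in> M) \<and>
     (\<forall>x\<in>M. act (mat 1) x = x) \<and>
     (\<forall>g\<in>G. \<forall>h\<in>G. \<forall>x\<in>M. act (g ** h) x = act g (act h x)) \<and>
     smooth_map_on (G \<times> M) (\<lambda>(g, x). act g x) \<and>
     (\<forall>x\<in>M. \<forall>y\<in>M. \<exists>g\<in>G. act g x = y)"

definition isotropy ::
  "(real^'n^'n) set \<Rightarrow> (real^'n^'n \<Rightarrow> 'v \<Rightarrow> 'v) \<Rightarrow> 'v::euclidean_space \<Rightarrow> (real^'n^'n) set" where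
  "isotropy G act x = {g \<in> G. act g x = x}"

definition infinitesimal_action ::
  "(real^'n^'n \<Rightarrow> 'v \<Rightarrow> 'v) \<Rightarrow> real^'n^'n \<Rightarrow> 'v \<Rightarrow> 'v::euclidean_space" where
  "infinitesimal_action act \<xi> x = frechet_derivative (\<lambda>g. act g x) (at (mat 1)) \<xi>"

definition tangent_action ::
  "(real^'n^'n \<Rightarrow> 'v \<Rightarrow> 'v) \<Rightarrow> real^'n^'n \<Rightarrow> 'v \<Rightarrow> 'v \<Rightarrow> 'v::euclidean_space" where
  "tangent_action act g x f = frechet_derivative (act g) (at x) f"

text \<open>One-forms on \<open>M\<close> are functions \<open>\<omega>\<close> of a point and a tangent vector; their values outside the
  tangent bundle are irrelevant.\<close>

definition one_form ::
  "(real^'n^'n) set \<Rightarrow> 'v::euclidean_space set \<Rightarrow> ('v \<Rightarrow> 'v \<Rightarrow> real^'n^'n) \<Rightarrow> bool" where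
  "one_form \<gg> M \<omega> \<longleftrightarrow>
     (\<forall>x\<in>M. \<forall>f\<in>tangent_space M x. \<omega> x f \<in> \<gg>) \<and>
     (\<forall>x\<in>M. \<forall>f1\<in>tangent_space M x. \<forall>f2\<in>tangent_space M x. \<forall>a b.
        \<omega> x (a *\<^sub>R f1 + b *\<^sub>R f2) = a *\<^sub>R \<omega> x f1 + b *\<^sub>R \<omega> x f2) \<and>
     smooth_map_on (tangent_bundle M) (\<lambda>(x, f). \<omega> x f)"

definition is_connection ::
  "(real^'n^'n) set \<Rightarrow> (real^'n^'n \<Rightarrow> 'v \<Rightarrow> 'v) \<Rightarrow> 'v::euclidean_space set \<Rightarrow>
   ('v \<Rightarrow> 'v \<Rightarrow> real^'n^'n) \<Rightarrow> bool" where
  "is_connection G act M \<omega> \<longleftrightarrow>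
     one_form (lie_algebra G) M \<omega> \<and>
     (\<forall>x\<in>M. \<forall>f\<in>tangent_space M x. infinitesimal_action act (\<omega> x f) x = f) \<and>
     (\<forall>g\<in>G. \<forall>x\<in>M. \<forall>f\<in>tangent_space M x.
        \<omega> (act g x) (tangent_action act g x f) = Ad g (\<omega> x f))"

definition reductive_structure ::
  "(real^'n^'n) set \<Rightarrow> (real^'n^'n \<Rightarrow> 'v \<Rightarrow> 'v) \<Rightarrow> 'v::euclidean_space \<Rightarrow> (real^'n^'n) set \<Rightarrow> bool"
where
  "reductive_structure G act orig \<mm> \<longleftrightarrow>
     subspace \<mm> \<and>
     lie_algebra (isotropy G act orig) \<inter> \<mm> = {0} \<and>
     {\<xi> + \<eta> |\<xi> \<eta>. \<xi> \<in> lie_algebra (isotropy G act orig) \<and> \<eta> \<in> \<mm>} = lie_algebra G \<and>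
     (\<forall>g\<in>isotropy G act orig. \<forall>\<xi>\<in>\<mm>. Ad g \<xi> \<in> \<mm>)"

definition induces_connection ::
  "(real^'n^'n) set \<Rightarrow> (real^'n^'n \<Rightarrow> 'v \<Rightarrow> 'v) \<Rightarrow> 'v::euclidean_space set \<Rightarrow> 'v \<Rightarrow>
   (real^'n^'n) set \<Rightarrow> ('v \<Rightarrow> 'v \<Rightarrow> real^'n^'n) \<Rightarrow> bool" where
  "induces_connection G act M orig \<mm> \<omega> \<longleftrightarrow>
     is_connection G act M \<omega> \<and> \<omega> orig ` tangent_space M orig = \<mm>"

definition flat_connection ::
  "'v::euclidean_space set \<Rightarrow> 'v \<Rightarrow> ('v \<Rightarrow> 'v \<Rightarrow> real^'n^'n) \<Rightarrow> bool" where
  "flat_connection M orig \<omega> \<longleftrightarrow>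
     (let \<mm> = \<omega> orig ` tangent_space M orig in \<forall>\<xi>\<in>\<mm>. \<forall>\<eta>\<in>\<mm>. lie_bracket \<xi> \<eta> \<in> \<mm>)"

definition symmetric_connection ::
  "(real^'n^'n) set \<Rightarrow> (real^'n^'n \<Rightarrow> 'v \<Rightarrow> 'v) \<Rightarrow> 'v::euclidean_space set \<Rightarrow> 'v \<Rightarrow>
   ('v \<Rightarrow> 'v \<Rightarrow> real^'n^'n) \<Rightarrow> bool" where
  "symmetric_connection G act M orig \<omega> \<longleftrightarrow>
     (let \<mm> = \<omega> orig ` tangent_space M orig in
      \<forall>\<xi>\<in>\<mm>. \<forall>\<eta>\<in>\<mm>. lie_bracket \<xi> \<eta> \<in> lie_algebra (isotropy G act orig))"

text \<open>Isomorphism of two manifolds acted upon by the same group: equivariant diffeomorphism.\<close>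

definition isomorphic_G_spaces ::
  "(real^'n^'n) set \<Rightarrow> (real^'n^'n \<Rightarrow> 'v \<Rightarrow> 'v) \<Rightarrow> 'v::euclidean_space set \<Rightarrow>
   (real^'n^'n \<Rightarrow> 'w \<Rightarrow> 'w) \<Rightarrow> 'w::euclidean_space set \<Rightarrow> bool" where
  "isomorphic_G_spaces G act M act' M' \<longleftrightarrow>
     (\<exists>\<phi>. bij_betw \<phi> M M' \<and> smooth_map_on M \<phi> \<and> smooth_map_on M' (inv_into M \<phi>) \<and>
          (\<forall>g\<in>G. \<forall>x\<in>M. \<phi> (act g x) = act' g (\<phi> x)))"

text \<open>Principal homogeneous spaces, and the variant in which the isotropy groups are trivial only
  up to a discrete group, that is, trivial at the level of Lie algebras.\<close>

definition principal_homogeneous_space ::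
  "(real^'n^'n) set \<Rightarrow> (real^'n^'n \<Rightarrow> 'v \<Rightarrow> 'v) \<Rightarrow> 'v::euclidean_space set \<Rightarrow> bool" where
  "principal_homogeneous_space G act M \<longleftrightarrow>
     homogeneous_space G act M \<and> (\<forall>x\<in>M. isotropy G act x = {mat 1})"

definition locally_principal_homogeneous_space ::
  "(real^'n^'n) set \<Rightarrow> (real^'n^'n \<Rightarrow> 'v \<Rightarrow> 'v) \<Rightarrow> 'v::euclidean_space set \<Rightarrow> bool" where
  "locally_principal_homogeneous_space G act M \<longleftrightarrow>
     homogeneous_space G act M \<and> (\<forall>x\<in>M. discrete (isotropy G act x))"


section \<open>Partitions and isospectral manifolds\<close>

type_synonym 'n square_matrix = "((real, 'n) vec, 'n) vec"

definition is_partition :: "(nat \<Rightarrow> nat) \<Rightarrow> bool" where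
  "is_partition \<kappa> \<longleftrightarrow> antimono \<kappa> \<and> eventually (\<lambda>i. \<kappa> i = 0) sequentially"

definition part_size :: "(nat \<Rightarrow> nat) \<Rightarrow> nat" where
  "part_size \<kappa> = (\<Sum>i | \<kappa> i \<noteq> 0. \<kappa> i)"

definition part_length :: "(nat \<Rightarrow> nat) \<Rightarrow> nat" where
  "part_length \<kappa> = card {i. \<kappa> i \<noteq> 0}"

text \<open>Matrices are indexed by a linearly ordered finite type \<open>'n\<close> with \<open>part_size \<kappa>\<close> elements. The
  first \<open>\<kappa> 0\<close> indices form block \<open>0\<close>, the next \<open>\<kappa> 1\<close> indices block \<open>1\<close>, and so on: an index
  preceded by exactly \<open>r\<close> others lies in block \<open>i\<close> iff
  \<open>\<kappa> 0 + \<dots> + \<kappa> (i - 1) \<le> r < \<kappa> 0 + \<dots> + \<kappa> i\<close>.\<close>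

definition block :: "(nat \<Rightarrow> nat) \<Rightarrow> 'n::{finite,linorder} \<Rightarrow> nat" where
  "block \<kappa> p = (LEAST i. card {q. q < p} < (\<Sum>j\<le>i. \<kappa> j))"

definition diag_matrix :: "('n \<Rightarrow> real) \<Rightarrow> real^'n^'n" where
  "diag_matrix c = (\<chi> p q. if p = q then c p else 0)"

definition SO :: "(real^'n^'n) set" where
  "SO = {R. rotation_matrix R}"

definition conj_action :: "real^'n^'n \<Rightarrow> real^'n^'n \<Rightarrow> real^'n^'n" where
  "conj_action R P = R ** P ** transpose R"

text \<open>For symmetric matrices algebraic and geometric multiplicities of eigenvalues agree; the
  multiplicity is taken to be the dimension of the eigenspace.\<close>

definition isospectral :: "(nat \<Rightarrow> nat) \<Rightarrow> (nat \<Rightarrow> real) \<Rightarrow> (real^'n^'n) set" where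
  "isospectral \<kappa> lam =
     {P. transpose P = P \<and> (\<forall>i < part_length \<kappa>. dim {v. P *v v = lam i *\<^sub>R v} = \<kappa> i)}"

definition Delta :: "(nat \<Rightarrow> nat) \<Rightarrow> (nat \<Rightarrow> real) \<Rightarrow> ('n::{finite,linorder}) square_matrix" where
  "Delta \<kappa> lam = diag_matrix (\<lambda>p. lam (block \<kappa> p))"

definition off_diagonal_blocks :: "(nat \<Rightarrow> nat) \<Rightarrow> ('n::{finite,linorder}) square_matrix set" where
  "off_diagonal_blocks \<kappa> =
     {\<xi>. transpose \<xi> = - \<xi> \<and> (\<forall>p q. block \<kappa> p = block \<kappa> q \<longrightarrow> \<xi> $ p $ q = 0)}"

definition grassmannian :: "nat \<Rightarrow> (real^'n^'n) set" where
  "grassmannian k = {P. transpose P = P \<and> P ** P = P \<and> rank P = k}"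

text \<open>The isotropy group at \<open>\<Delta>\<close> is never trivial in dimension at least two, whatever \<open>\<kappa>\<close> is: it
  contains the diagonal matrices with an even number of entries \<open>-1\<close> and all others \<open>1\<close>. So no
  isospectral manifold is a principal homogeneous space in the strict sense, and discreteness of
  the isotropy groups is what can hold.\<close>

lemma isotropy_Delta_nontrivial:
  assumes "CARD('n::{finite,linorder}) \<ge> 2"
  shows "isotropy (SO :: ('n square_matrix) set) conj_action (Delta \<kappa> lam) \<noteq> {mat 1}"
proof -
  obtain p q :: 'n where pq: "p \<noteq> q"
    using assms by (metis (full_types) UNIV_I card_2_iff' card_le_Suc0_iff_eq finite not_less_eq_eq numeral_2_eq_2)
  define c :: "'n \<Rightarrow> real" where "c = (\<lambda>r. if r = p \<or> r = q then -1 else 1)"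
  define R :: "'n square_matrix" where "R = diag_matrix c"
  have cc: "c r * c r = 1" for r by (simp add: c_def)
  have mult: "diag_matrix a ** diag_matrix b = (diag_matrix (\<lambda>r. a r * b r) :: 'n square_matrix)" for a b
    by (simp add: diag_matrix_def matrix_matrix_mult_def vec_eq_iff if_distrib[of "\<lambda>x. x * _"]
        sum.delta' cong: if_cong)
  have tr: "transpose R = R"
    by (auto simp: R_def diag_matrix_def transpose_def vec_eq_iff)
  have id: "(diag_matrix (\<lambda>r. 1) :: 'n square_matrix) = mat 1"
    by (simp add: diag_matrix_def mat_def)
  have RR: "R ** R = mat 1"
    using id by (simp add: R_def mult cc)
  have "det R = (\<Prod>r\<in>UNIV. c r)"
    by (subst det_diagonal) (auto simp: R_def diag_matrix_def)
  also have "\<dots> = (\<Prod>r\<in>{p, q}. c r)"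
    by (rule prod.mono_neutral_right) (auto simp: c_def)
  also have "\<dots> = 1" using pq by (simp add: c_def)
  finally have "R \<in> SO"
    using RR tr by (simp add: SO_def rotation_matrix_def orthogonal_matrix_def)
  moreover have "conj_action R (Delta \<kappa> lam) = Delta \<kappa> lam"
  proof -
    have cxc: "c r * x * c r = x" for r x
      using cc[of r] by (metis mult.assoc mult.commute mult_1)
    show ?thesis
      unfolding conj_action_def tr unfolding R_def Delta_def mult cxc ..
  qed
  moreover have "R \<noteq> mat 1"
  proof
    assume "R = mat 1"
    then have "R $ p $ p = 1" by (simp add: mat_def)
    then show False by (simp add: R_def diag_matrix_def c_def)
  qed
  ultimately show ?thesis by (auto simp: isotropy_def)
qed

corollary not_principal_homogeneous_space:
  fixes M :: "('n::{finite,linorder}) square_matrix set"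
  assumes "CARD('n) \<ge> 2" and "Delta \<kappa> lam \<in> M"
  shows "\<not> principal_homogeneous_space SO conj_action M"
  using assms isotropy_Delta_nontrivial unfolding principal_homogeneous_space_def by blast

end

theory Submission
  imports Defs
begin

text \<open>Lagrange interpolation gives spectral projectors \<open>E i P\<close> that are polynomial in \<open>P\<close>, and a
  matrix \<open>A\<close> is determined by its corners \<open>E i P ** A ** E j P\<close>. On such a corner the
  infinitesimal action \<open>\<xi> \<mapsto> \<xi> ** P - P ** \<xi>\<close> is multiplication by \<open>lam j - lam i\<close>, so it is
  inverted by dividing the off-diagonal corners of a tangent vector by these differences. This
  yields the connection as a polynomial in \<open>P\<close>, hence its smoothness, and with two eigenvalues it
  reduces to the commutator with \<open>P\<close> divided by the square of their difference. Flatness and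
  symmetry are decided by brackets of elementary skew-symmetric matrices.\<close>

section \<open>Matrix algebra\<close>

text \<open>Smoothness means local extension to the ambient space, and tangent vectors are
  velocities of curves. Polynomial projectors suit both: they are smooth on all matrices and commute
  with conjugation, so their identities on \<open>M\<close> are carried along the orbit to
  \<open>Delta\<close>, where they concern 0-1 diagonal matrices. Tangent spaces need two bounds.
  Differentiating the eigenvalue equation of a projector along a curve shows that a velocity has no
  diagonal corners; curves of rotations with prescribed skew velocity realize every symmetric matrix
  without diagonal corners. The inverse square for two eigenvalues arises because the connection
  divides the corner \<open>(i, j)\<close> by \<open>lam j - lam i\<close> while the commutator
  multiplies by it; a square ignores the sign, so one constant serves both off-diagonal corners. A
  connection inducing \<open>off_diagonal_blocks\<close> is forced at \<open>Delta\<close>, since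
  its values there have no diagonal corners, and elsewhere by equivariance. Hence a claim about all
  such connections is a claim about a single one.\<close>

lemma bounded_bilinear_matrix_mult:
  "bounded_bilinear ((**) :: real^'n^'m \<Rightarrow> real^'k^'n \<Rightarrow> real^'k^'m)"
  unfolding bilinear_conv_bounded_bilinear [symmetric] bilinear_def
  by (auto intro!: linearI simp: matrix_matrix_mult_def vec_eq_iff algebra_simps sum.distrib sum_distrib_left)

text \<open>One bilinear bound provides distributivity, limits, continuity and the product rule for
  \<open>**\<close>.\<close>

interpretation mm: bounded_bilinear "(**) :: real^'n^'m \<Rightarrow> real^'k^'n \<Rightarrow> real^'k^'m"
  by (rule bounded_bilinear_matrix_mult)

lemma bounded_linear_transpose: "bounded_linear (transpose :: real^'n^'m \<Rightarrow> real^'m^'n)"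
  by (auto intro!: linearI simp: linear_conv_bounded_linear [symmetric] transpose_def vec_eq_iff)

lemmas transpose_add = linear_add [OF bounded_linear.linear [OF bounded_linear_transpose]]
  and transpose_diff = linear_diff [OF bounded_linear.linear [OF bounded_linear_transpose]]
  and transpose_minus = linear_neg [OF bounded_linear.linear [OF bounded_linear_transpose]]
  and transpose_zero = linear_0 [OF bounded_linear.linear [OF bounded_linear_transpose]]

lemmas matrix_ring = mm.add_left mm.add_right mm.diff_left mm.diff_right mm.minus_left mm.minus_right
  mm.scaleR_left mm.scaleR_right matrix_mul_assoc

lemmas transpose_ring = transpose_add transpose_diff transpose_minus transpose_scalar matrix_transpose_mul

lemma diag_matrix_mult:
  "diag_matrix a ** diag_matrix b = (diag_matrix (\<lambda>r. a r * b r) :: real^'n^'n)"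
  by (simp add: diag_matrix_def matrix_matrix_mult_def vec_eq_iff if_distrib[of "\<lambda>x. x * _"]
      sum.delta' cong: if_cong)

lemma diag_matrix_nth: "(diag_matrix c :: real^'n^'n) $ p $ q = (if p = q then c p else 0)"
  by (simp add: diag_matrix_def)

lemma transpose_diag_matrix: "transpose (diag_matrix c) = (diag_matrix c :: real^'n^'n)"
  by (auto simp: diag_matrix_def transpose_def vec_eq_iff)

lemma diag_matrix_one: "diag_matrix (\<lambda>p. 1) = (mat 1 :: real^'n^'n)"
  by (simp add: diag_matrix_def mat_def)

lemma diag_matrix_mult_left_nth: "(diag_matrix c ** (A :: real^'n^'n)) $ p $ q = c p * A $ p $ q"
  by (simp add: diag_matrix_def matrix_matrix_mult_def if_distrib[of "\<lambda>x. x * _"] cong: if_cong)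

lemma diag_matrix_mult_right_nth: "((A :: real^'n^'n) ** diag_matrix c) $ p $ q = A $ p $ q * c q"
  by (simp add: diag_matrix_def matrix_matrix_mult_def if_distrib[of "\<lambda>x. _ * x"] cong: if_cong)

lemma diag_matrix_mult_vec_nth: "(diag_matrix c *v v) $ p = c p * (v :: real^'n) $ p"
  by (simp add: diag_matrix_def matrix_vector_mult_def if_distrib[of "\<lambda>x. x * _"] cong: if_cong)

lemma transpose_eq_minus_iff: "transpose A = - A \<longleftrightarrow> (\<forall>p q. (A :: real^'n^'n) $ q $ p = - A $ p $ q)"
  by (auto simp: vec_eq_iff transpose_def)

section \<open>Rotation matrices and their action by conjugation\<close>

lemma orthogonal_matrix_inv:
  assumes "orthogonal_matrix (R :: real^'n^'n)"
  shows "matrix_inv R = transpose R"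
proof -
  have R: "transpose R ** R = mat 1" "R ** transpose R = mat 1"
    using assms by (auto simp: orthogonal_matrix_def)
  have "R ** matrix_inv R = mat 1 \<and> matrix_inv R ** R = mat 1"
    unfolding matrix_inv_def by (rule someI [of _ "transpose R"]) (use R in auto)
  then show ?thesis
    by (metis R(1) matrix_mul_assoc matrix_mul_lid matrix_mul_rid)
qed

lemma SO_D:
  assumes "R \<in> SO"
  shows "orthogonal_matrix R" "transpose R ** R = mat 1" "R ** transpose R = mat 1" "det R = 1"
    "matrix_inv R = transpose R" "transpose R \<in> SO"
  using assms orthogonal_matrix_inv
  by (auto simp: SO_def rotation_matrix_def orthogonal_matrix_def)

lemma SO_I: "transpose R ** R = mat 1 \<Longrightarrow> det R = 1 \<Longrightarrow> R \<in> SO"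
  by (auto simp: SO_def rotation_matrix_def orthogonal_matrix)

lemma one_in_SO: "mat 1 \<in> SO"
  by (rule SO_I) auto

lemma SO_mult: "R \<in> SO \<Longrightarrow> S \<in> SO \<Longrightarrow> R ** S \<in> SO"
  by (auto simp: SO_def rotation_matrix_def orthogonal_matrix_mul det_mul)

text \<open>The last two forms fit the left-nested products that \<open>matrix_mul_assoc\<close>
  produces, in which \<open>transpose R ** R\<close> is no longer a subterm.\<close>

lemma orthogonal_matrix_cancel:
  assumes "orthogonal_matrix (R :: real^'n^'n)"
  shows "transpose R ** R = mat 1" "R ** transpose R = mat 1"
    "A ** transpose R ** R = A" "A ** R ** transpose R = A"
  using assms by (auto simp: orthogonal_matrix_def simp flip: matrix_mul_assoc)

lemma matrix_group_SO: "matrix_group (SO :: (real^'n^'n) set)"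
  unfolding matrix_group_def
  using SO_D(2,3) by (auto simp: one_in_SO SO_mult SO_D(5,6) invertible_def)

text \<open>Rows are unit vectors, and the norm is at most the sum of the row norms. This crude
  bound serves both the compactness of \<open>SO\<close> and the continuity at 0 in
  \<open>SO_curve\<close>.\<close>

lemma norm_orthogonal_matrix_le:
  assumes "orthogonal_matrix (R :: real^'n^'n)"
  shows "norm R \<le> CARD('n)"
proof -
  have "norm (R $ i) = 1" for i
    using assms by (auto simp: orthogonal_matrix_orthonormal_rows row_def)
  then have "(\<Sum>i\<in>UNIV. norm (R $ i)) = CARD('n)" by simp
  moreover have "norm R \<le> (\<Sum>i\<in>UNIV. norm (R $ i))"
    by (simp add: norm_vec_def L2_set_le_sum)
  ultimately show ?thesis by simp
qed

lemma compact_SO: "compact (SO :: (real^'n^'n) set)"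
proof -
  have "bounded (SO :: (real^'n^'n) set)"
    unfolding bounded_iff using norm_orthogonal_matrix_le SO_D(1) by blast
  moreover have "closed (SO :: (real^'n^'n) set)"
  proof -
    have eq: "(SO :: (real^'n^'n) set) = {R. transpose R ** R = mat 1} \<inter> {R. det R = 1}"
      using SO_I SO_D by blast
    show ?thesis
      unfolding eq det_def
      by (intro  closed_Int closed_Collect_eq mm.continuous_on continuous_intros
          bounded_linear.continuous_on[OF bounded_linear_transpose])
  qed
  ultimately show ?thesis
    by (simp add: compact_eq_bounded_closed)
qed

lemma conj_action_id: "conj_action (mat 1) P = P"
  by (simp add: conj_action_def)

lemma conj_action_mult: "conj_action (R ** S) P = conj_action R (conj_action S P)"
  by (simp add: conj_action_def matrix_transpose_mul matrix_mul_assoc)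

lemma conj_action_fix_iff:
  assumes "R \<in> SO"
  shows "conj_action R P = P \<longleftrightarrow> R ** P = P ** R"
proof
  assume "conj_action R P = P"
  then have "R ** P ** transpose R ** R = P ** R" by (simp add: conj_action_def)
  then show "R ** P = P ** R" by (simp add: orthogonal_matrix_cancel[OF SO_D(1)[OF assms]])
next
  assume "R ** P = P ** R"
  then show "conj_action R P = P"
    by (simp add: conj_action_def orthogonal_matrix_cancel[OF SO_D(1)[OF assms]])
qed

text \<open>Fixing \<open>P\<close> becomes an equation linear in \<open>R\<close>, which can be
  differentiated along curves and solved entrywise at \<open>Delta\<close>.\<close>

lemma isotropy_SO: "isotropy SO conj_action P = {R \<in> SO. R ** P = P ** R}"
  using conj_action_fix_iff by (auto simp: isotropy_def)

lemma bounded_linear_conj_action: "bounded_linear (conj_action R)"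
  unfolding conj_action_def
  by (intro bounded_linear_compose[OF mm.bounded_linear_left] mm.bounded_linear_right)

lemma tangent_action_conj: "tangent_action conj_action R P f = R ** f ** transpose R"
  using frechet_derivative_at [OF bounded_linear.has_derivative [OF bounded_linear_conj_action has_derivative_ident]]
  by (metis conj_action_def tangent_action_def)

text \<open>The derivative at \<open>mat 1\<close> is taken in the space of all matrices, so
  \<open>\<xi>\<close> is arbitrary and its transpose remains. For skew \<open>\<xi>\<close> the
  right side is the commutator \<open>\<xi> ** P - P ** \<xi>\<close>.\<close>

lemma infinitesimal_conj_action:
  "infinitesimal_action conj_action \<xi> P = \<xi> ** P + P ** transpose \<xi>"
proof -
  have "((\<lambda>R. conj_action R P) has_derivative (\<lambda>\<xi>. \<xi> ** P + P ** transpose \<xi>)) (at (mat 1))"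
    unfolding conj_action_def
    by (rule has_derivative_eq_rhs, rule mm.FDERIV[OF mm.FDERIV[OF has_derivative_ident has_derivative_const]
          bounded_linear.has_derivative[OF bounded_linear_transpose has_derivative_ident]])
      (simp add: mm.zero_right add.commute)
  then show ?thesis
    unfolding infinitesimal_action_def by (simp flip: frechet_derivative_at)
qed

section \<open>Smooth maps on the whole space\<close>

text \<open>Lets a derivative be supplied by a formula; uniqueness identifies it with the
  \<open>frechet_derivative\<close> in terms of which \<open>Ck_on\<close> is defined.\<close>

lemma Ck_on_Suc_I:
  assumes "\<And>x. (f has_derivative f' x) (at x)" "\<And>v. Ck_on n UNIV (\<lambda>x. f' x v)"
  shows "Ck_on (Suc n) UNIV f"
proof -
  have "frechet_derivative f (at x) = f' x" for x
    using frechet_derivative_at[OF assms(1)] by simp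
  then show ?thesis
    using assms by (auto simp: differentiable_def)
qed

lemma Ck_on_SucD:
  assumes "Ck_on (Suc n) UNIV f"
  shows "(f has_derivative frechet_derivative f (at x)) (at x)"
    "Ck_on n UNIV (\<lambda>x. frechet_derivative f (at x) v)"
  using assms frechet_derivative_works by auto

text \<open>The product rule leaves one factor undifferentiated, whose order of differentiability
  must then be lowered by one.\<close>

lemma Ck_on_Suc_imp: "Ck_on (Suc n) UNIV f \<Longrightarrow> Ck_on n UNIV f"
proof (induction n arbitrary: f)
  case 0
  then show ?case
    by (auto intro!: differentiable_imp_continuous_on simp: differentiable_on_def
        intro: differentiable_at_imp_differentiable_on)
next
  case (Suc n)
  show ?case
    using Suc.prems Suc.IH by (metis Ck_on.simps(2))
qed

lemma Ck_on_const: "Ck_on n UNIV (\<lambda>x. c)"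
proof (induction n arbitrary: c)
  case (Suc n)
  show ?case by (rule Ck_on_Suc_I [where f' = "\<lambda>x v. 0"]) (auto simp: Suc)
qed auto

lemma Ck_on_bounded_linear: "bounded_linear f \<Longrightarrow> Ck_on n UNIV f"
proof (cases n)
  case 0
  assume "bounded_linear f"
  then show ?thesis using 0 by (simp add: linear_continuous_on)
next
  case (Suc m)
  assume "bounded_linear f"
  then show ?thesis
    unfolding Suc by (intro Ck_on_Suc_I [where f' = "\<lambda>x v. f v"] Ck_on_const bounded_linear_imp_has_derivative)
qed

lemma Ck_on_add: "Ck_on n UNIV f \<Longrightarrow> Ck_on n UNIV g \<Longrightarrow> Ck_on n UNIV (\<lambda>x. f x + g x)"
proof (induction n arbitrary: f g)
  case (Suc n)
  show ?case
    by (rule Ck_on_Suc_I)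
      (auto intro!: has_derivative_add Ck_on_SucD[OF Suc.prems(1)] Ck_on_SucD[OF Suc.prems(2)] Suc.IH)
qed (auto intro: continuous_intros)

lemma Ck_on_bounded_bilinear:
  assumes "bounded_bilinear h"
  shows "Ck_on n UNIV f \<Longrightarrow> Ck_on n UNIV g \<Longrightarrow> Ck_on n UNIV (\<lambda>x. h (f x) (g x))"
proof (induction n arbitrary: f g)
  case 0
  then show ?case using bounded_bilinear.continuous_on[OF assms] by auto
next
  case (Suc n)
  show ?case
    by (rule Ck_on_Suc_I)
      (auto intro!: bounded_bilinear.FDERIV[OF assms] Ck_on_SucD[OF Suc.prems(1)] Ck_on_SucD[OF Suc.prems(2)]
        Ck_on_add Suc.IH Ck_on_Suc_imp[OF Suc.prems(1)] Ck_on_Suc_imp[OF Suc.prems(2)])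
qed

lemma Ck_on_matrix_mult:
  fixes f :: "'a::euclidean_space \<Rightarrow> real^'n^'m" and g :: "'a \<Rightarrow> real^'k^'n"
  shows "Ck_on n UNIV f \<Longrightarrow> Ck_on n UNIV g \<Longrightarrow> Ck_on n UNIV (\<lambda>x. f x ** g x)"
  by (rule Ck_on_bounded_bilinear[OF bounded_bilinear_matrix_mult])

lemma Ck_on_scaleR: "Ck_on n UNIV f \<Longrightarrow> Ck_on n UNIV (\<lambda>x. c *\<^sub>R f x)"
  by (rule Ck_on_bounded_bilinear[OF bounded_bilinear_scaleR Ck_on_const])

lemma Ck_on_diff: "Ck_on n UNIV f \<Longrightarrow> Ck_on n UNIV g \<Longrightarrow> Ck_on n UNIV (\<lambda>x. f x - g x)"
  using Ck_on_add[OF _ Ck_on_scaleR[of n g "-1"]] by fastforce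

lemma Ck_on_sum: "(\<And>i. i \<in> I \<Longrightarrow> Ck_on n UNIV (f i)) \<Longrightarrow> Ck_on n UNIV (\<lambda>x. \<Sum>i\<in>I. f i x)"
  by (induction I rule: infinite_finite_induct) (auto intro: Ck_on_const Ck_on_add)

lemmas Ck_on_intros = Ck_on_const Ck_on_matrix_mult Ck_on_scaleR Ck_on_diff Ck_on_add Ck_on_sum

text \<open>The maps treated below are restrictions of maps that are smooth on the whole ambient
  space, so a single global extension suffices.\<close>

lemma smooth_map_onI:
  assumes "\<And>n. Ck_on n UNIV F" "\<And>x. x \<in> S \<Longrightarrow> F x = f x"
  shows "smooth_map_on S f"
  unfolding smooth_map_on_def using assms by (intro ballI exI[of _ UNIV] exI[of _ F]) auto

text \<open>Written with the transpose in place of the inverse, the action is a polynomial in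
  \<open>g\<close> and \<open>x\<close>, defined for all matrices.\<close>

lemma smooth_conj_action: "smooth_map_on (SO \<times> M) (\<lambda>(g, x). conj_action g x)"
proof (rule smooth_map_onI)
  fix n
  show "Ck_on n UNIV (\<lambda>z :: (real^'n^'n) \<times> (real^'n^'n). fst z ** snd z ** transpose (fst z))"
    by (intro Ck_on_intros Ck_on_bounded_linear bounded_linear_fst bounded_linear_snd
        bounded_linear_compose[OF bounded_linear_transpose])
qed (auto simp: conj_action_def)

section \<open>Curves of rotations\<close>

text \<open>The Cayley transform replaces the exponential map: \<open>exp\<close> is defined for Banach algebras, and
  the type \<open>real^'n^'n\<close> is not an instance of that class.\<close>

lemma cayley_transform:
  assumes A: "transpose A = - (A :: real^'n^'n)"
  obtains C where "C \<in> SO" "C - mat 1 = A ** (C + mat 1)" "\<And>D. A ** D = D ** A \<Longrightarrow> C ** D = D ** C"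
proof -
  \<comment> \<open>The matrix sought is \<open>C = (1 - A)^(-1) (1 + A)\<close>. By skewness
    \<open>1 + A\<close> is the transpose of \<open>B\<close>, so everything is expressed through
    \<open>B\<close>.\<close>
  define B where "B = mat 1 - A"
  have Bt: "transpose B = mat 1 + A" by (simp add: B_def transpose_ring A)
  have comm: "B ** transpose B = transpose B ** B"
    unfolding Bt by (simp add: B_def matrix_ring)
  \<comment> \<open>A kernel vector of \<open>B\<close> satisfies \<open>A *v v = v\<close>, but
    \<open>v\<close> is orthogonal to \<open>A *v v\<close> by skewness. So \<open>B\<close> is
    invertible.\<close>
  have "v = 0" if "B *v v = 0" for v
  proof -
    have "v \<bullet> (A *v v) = - (v \<bullet> (A *v v))"
    proof -
      have "v \<bullet> (A *v v) = (transpose A *v v) \<bullet> v" by (simp add: dot_lmul_matrix)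
      also have "transpose A *v v = - (A *v v)"
        unfolding A by (simp add: matrix_vector_mult_def vec_eq_iff sum_negf)
      finally show ?thesis by (simp add: inner_commute)
    qed
    then have "v \<bullet> (A *v v) = 0" by simp
    moreover have "A *v v = v" using that by (simp add: B_def matrix_vector_mult_diff_rdistrib)
    ultimately show "v = 0" by simp
  qed
  then obtain N where N: "N ** B = mat 1" "B ** N = mat 1"
    using matrix_left_invertible_ker[of B] matrix_left_right_inverse by metis
  define C where "C = N ** transpose B"
  have NBt: "N ** transpose B = transpose B ** N"
  proof -
    have "N ** (B ** transpose B) ** N = N ** (transpose B ** B) ** N" by (simp add: comm)
    then show ?thesis using N by (metis matrix_mul_assoc matrix_mul_lid matrix_mul_rid)
  qed
  have Nt: "transpose N ** transpose B = mat 1" "transpose B ** transpose N = mat 1"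
    using N by (metis matrix_transpose_mul transpose_mat)+
  have "transpose C ** C = B ** transpose N ** (transpose B ** N)"
    by (simp add: C_def matrix_transpose_mul flip: NBt)
  also have "\<dots> = B ** (transpose N ** transpose B) ** N" by (simp add: matrix_mul_assoc)
  also have "\<dots> = mat 1" by (simp add: Nt N)
  finally have "transpose C ** C = mat 1" .
  \<comment> \<open>\<open>B\<close> and its transpose have the same determinant, which cancels
    against that of the inverse \<open>N\<close>.\<close>
  moreover have "det C = 1"
  proof -
    have "det C = det N * det B" by (simp add: C_def det_mul det_transpose)
    also have "\<dots> = 1" by (metis N(1) det_I det_mul)
    finally show ?thesis .
  qed
  ultimately have 1: "C \<in> SO" by (rule SO_I)
  have BC: "B ** C = transpose B" unfolding C_def by (simp add: matrix_mul_assoc N)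
  then have "(mat 1 - A) ** C = mat 1 + A" by (simp only: Bt flip: B_def)
  \<comment> \<open>This form contains no inverse; \<open>SO_curve\<close> reads the difference
    quotient off it.\<close>
  then have 2: "C - mat 1 = A ** (C + mat 1)"
    by (simp add: matrix_ring algebra_simps)
  \<comment> \<open>After multiplication by the invertible \<open>B\<close> only \<open>A\<close> is
    left to be moved past \<open>D\<close>.\<close>
  have 3: "C ** D = D ** C" if D: "A ** D = D ** A" for D
  proof -
    have "B ** (C ** D) = B ** (D ** C)"
    proof -
      have "B ** (C ** D) = transpose B ** D" by (simp add: BC matrix_mul_assoc)
      also have "\<dots> = D ** transpose B" unfolding Bt by (simp add: D matrix_ring)
      also have "\<dots> = D ** B ** C" by (simp add: BC flip: matrix_mul_assoc)
      also have "\<dots> = B ** (D ** C)" by (simp add: B_def D matrix_ring)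
      finally show ?thesis .
    qed
    then show ?thesis using N by (metis matrix_mul_assoc matrix_mul_lid)
  qed
  show ?thesis by (rule that[OF 1 2 3])
qed

lemma has_vector_derivative_atI:
  assumes "((\<lambda>h. (f (x + h) - f x) /\<^sub>R h) \<longlongrightarrow> D) (at 0)"
  shows "(f has_vector_derivative D) (at x)"
proof -
  have "((\<lambda>h. norm ((f (x + h) - f x) /\<^sub>R h - D)) \<longlongrightarrow> 0) (at 0)"
    using assms by (simp add: LIM_zero_iff tendsto_norm_zero_iff)
  moreover have "norm ((f (x + h) - f x) /\<^sub>R h - D) = norm (f (x + h) - f x - h *\<^sub>R D) / norm h"
    if "h \<noteq> 0" for h
  proof -
    have "f (x + h) - f x - h *\<^sub>R D = h *\<^sub>R ((f (x + h) - f x) /\<^sub>R h - D)"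
      using that by (simp add: scaleR_diff_right)
    then show ?thesis using that by simp
  qed
  then have "\<forall>\<^sub>F h in at 0. norm ((f (x + h) - f x) /\<^sub>R h - D) = norm (f (x + h) - f x - h *\<^sub>R D) / norm h"
    by (simp add: eventually_at_filter)
  ultimately have "((\<lambda>h. norm (f (x + h) - f x - h *\<^sub>R D) / norm h) \<longlongrightarrow> 0) (at 0)"
    using tendsto_cong by force
  then show ?thesis
    by (simp add: has_vector_derivative_def has_derivative_at bounded_linear_scaleR_left)
qed

text \<open>The commutation clause keeps the curve inside the isotropy group of any matrix commuting
  with \<open>\<xi>\<close>. Tangent spaces ask for differentiability at 0 only, so the points of
  the curve may be chosen separately for each \<open>t\<close>.\<close>

lemma SO_curve:
  assumes \<xi>: "transpose \<xi> = - (\<xi> :: real^'n^'n)"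
  obtains \<gamma> :: "real \<Rightarrow> real^'n^'n" where "\<gamma> 0 = mat 1" "\<And>t. \<gamma> t \<in> SO"
    "\<And>t D. \<xi> ** D = D ** \<xi> \<Longrightarrow> \<gamma> t ** D = D ** \<gamma> t"
    "(\<gamma> has_vector_derivative \<xi>) (at 0)"
proof -
  \<comment> \<open>To first order the Cayley transform of \<open>A\<close> is
    \<open>1 + 2 A\<close>, hence the factor one half.\<close>
  define A where "A t = (t / 2) *\<^sub>R \<xi>" for t
  have "\<exists>C\<in>SO. C - mat 1 = A t ** (C + mat 1) \<and> (\<forall>D. \<xi> ** D = D ** \<xi> \<longrightarrow> C ** D = D ** C)" for t
  proof -
    have "transpose (A t) = - A t" by (simp add: A_def transpose_ring \<xi>)
    from cayley_transform[OF this] obtain C where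
      "C \<in> SO" "C - mat 1 = A t ** (C + mat 1)" "\<And>D. A t ** D = D ** A t \<Longrightarrow> C ** D = D ** C"
      by blast
    moreover from this(3) have "C ** D = D ** C" if "\<xi> ** D = D ** \<xi>" for D
      using that by (simp add: A_def matrix_ring)
    ultimately show ?thesis by blast
  qed
  then obtain \<gamma> where \<gamma>: "\<And>t. \<gamma> t \<in> SO" "\<And>t. \<gamma> t - mat 1 = A t ** (\<gamma> t + mat 1)"
    "\<And>t D. \<xi> ** D = D ** \<xi> \<Longrightarrow> \<gamma> t ** D = D ** \<gamma> t" by metis
  have \<gamma>0: "\<gamma> 0 = mat 1" using \<gamma>(2)[of 0] by (simp add: A_def mm.zero_left)
  have bnd: "norm (\<gamma> t) \<le> CARD('n)" for t
    by (rule norm_orthogonal_matrix_le) (rule SO_D(1)[OF \<gamma>(1)])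
  \<comment> \<open>Dividing by \<open>t\<close> turns this into an exact formula for the difference
    quotient, so continuity of \<open>\<gamma>\<close> at 0 already yields the derivative.\<close>
  have eq: "\<gamma> t - mat 1 = (t / 2) *\<^sub>R (\<xi> ** (\<gamma> t + mat 1))" for t
    using \<gamma>(2)[of t] by (simp add: A_def mm.scaleR_left)
  obtain K where K: "\<And>a b. norm ((a :: real^'n^'n) ** (b :: real^'n^'n)) \<le> norm a * norm b * K" "K > 0"
    using mm.pos_bounded by blast
  \<comment> \<open>The right side of \<open>eq\<close> is \<open>t\<close> times a bounded
    quantity, because rotations are bounded.\<close>
  have cont: "(\<gamma> \<longlongrightarrow> mat 1) (at 0)"
  proof (rule Lim_null[THEN iffD2], rule Lim_transform_bound)
    define c where "c = norm \<xi> * (CARD('n) + norm (mat 1 :: real^'n^'n)) * K"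
    show "\<forall>\<^sub>F t in at 0. norm (\<gamma> t - mat 1) \<le> norm (\<bar>t / 2\<bar> * c)"
    proof (rule always_eventually, rule allI)
      fix t
      have "norm (\<xi> ** (\<gamma> t + mat 1)) \<le> norm \<xi> * norm (\<gamma> t + mat 1) * K" by (rule K)
      also have "\<dots> \<le> norm \<xi> * (CARD('n) + norm (mat 1 :: real^'n^'n)) * K"
        using K by (intro mult_right_mono mult_left_mono order_trans[OF norm_triangle_ineq] add_right_mono bnd) auto
      finally have "\<bar>t / 2\<bar> * norm (\<xi> ** (\<gamma> t + mat 1)) \<le> \<bar>t / 2\<bar> * c"
        unfolding c_def by (rule mult_left_mono) simp
      moreover have "norm (\<gamma> t - mat 1) = \<bar>t / 2\<bar> * norm (\<xi> ** (\<gamma> t + mat 1))" by (subst eq) simp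
      ultimately show "norm (\<gamma> t - mat 1) \<le> norm (\<bar>t / 2\<bar> * c)"
        unfolding real_norm_def by linarith
    qed
    show "((\<lambda>t. \<bar>t / 2\<bar> * c) \<longlongrightarrow> 0) (at 0)" by (auto intro!: tendsto_eq_intros)
  qed
  have "((\<lambda>t. (1 / 2) *\<^sub>R (\<xi> ** (\<gamma> t + mat 1))) \<longlongrightarrow> (1 / 2) *\<^sub>R (\<xi> ** (mat 1 + mat 1))) (at 0)"
    by (intro tendsto_intros mm.tendsto cont)
  moreover have "(1 / 2) *\<^sub>R (\<xi> ** (mat 1 + mat 1)) = \<xi>"
    by (simp add: matrix_ring flip: scaleR_left_distrib scaleR_2)
  moreover have "\<forall>\<^sub>F t in at 0. (1 / 2) *\<^sub>R (\<xi> ** (\<gamma> t + mat 1)) = (\<gamma> (0 + t) - \<gamma> 0) /\<^sub>R t"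
  proof -
    have "(1 / 2) *\<^sub>R (\<xi> ** (\<gamma> t + mat 1)) = (\<gamma> (0 + t) - \<gamma> 0) /\<^sub>R t" if "t \<noteq> 0" for t
      unfolding \<gamma>0 add_0 eq using that by simp
    then show ?thesis by (simp add: eventually_at_filter)
  qed
  ultimately have "((\<lambda>t. (\<gamma> (0 + t) - \<gamma> 0) /\<^sub>R t) \<longlongrightarrow> \<xi>) (at 0)"
    using tendsto_cong by force
  then have "(\<gamma> has_vector_derivative \<xi>) (at 0)"
    by (rule has_vector_derivative_atI)
  then show ?thesis using that \<gamma>0 \<gamma>(1,3) by blast
qed

section \<open>Blocks of a partition\<close>

lemma finite_downset_nat_eq:
  fixes A :: "nat set"
  assumes "finite A" "\<And>i j. i \<le> j \<Longrightarrow> j \<in> A \<Longrightarrow> i \<in> A"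
  shows "A = {..<card A}"
proof (cases "A = {}")
  case False
  then have "Max A \<in> A" using assms(1) by simp
  then have "i \<in> A \<longleftrightarrow> i \<le> Max A" for i
    using assms(2)[of i "Max A"] Max_ge[OF assms(1)] by blast
  then obtain m where "A = {..m}" by blast
  then show ?thesis by (simp add: lessThan_Suc_atMost)
qed auto

text \<open>The support is downward closed because \<open>\<kappa>\<close> is non-increasing, and
  finite because \<open>\<kappa>\<close> is eventually zero.\<close>

lemma partition_support:
  assumes "is_partition \<kappa>"
  shows "{i. \<kappa> i \<noteq> 0} = {..<part_length \<kappa>}"
  unfolding part_length_def
proof (rule finite_downset_nat_eq)
  obtain N where "\<forall>i\<ge>N. \<kappa> i = 0"
    using assms by (auto simp: is_partition_def eventually_sequentially)
  then have "{i. \<kappa> i \<noteq> 0} \<subseteq> {..<N}"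
    by (metis (mono_tags, lifting) lessThan_iff linorder_not_le mem_Collect_eq subsetI)
  then show "finite {i. \<kappa> i \<noteq> 0}" by (rule finite_subset) simp
next
  fix i j :: nat
  assume "i \<le> j" "j \<in> {i. \<kappa> i \<noteq> 0}"
  moreover have "\<kappa> j \<le> \<kappa> i" using assms \<open>i \<le> j\<close> by (auto simp: is_partition_def antimono_def)
  ultimately show "i \<in> {i. \<kappa> i \<noteq> 0}" by auto
qed

text \<open>The position of an index in the linear order is strictly increasing, hence injective,
  and surjective by counting.\<close>

lemma bij_betw_card_less:
  "bij_betw (\<lambda>p :: 'n::{finite,linorder}. card {q. q < p}) UNIV {..<CARD('n)}"
proof -
  let ?r = "\<lambda>p :: 'n. card {q. q < p}"
  have less: "?r p < ?r q" if "p < q" for p q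
    by (rule psubset_card_mono) (use that in auto)
  have inj: "inj ?r"
  proof (rule injI)
    fix p q assume "?r p = ?r q"
    then show "p = q" using less[of p q] less[of q p] by (cases p q rule: linorder_cases) auto
  qed
  have "range ?r \<subseteq> {..<CARD('n)}"
    by (auto intro!: psubset_card_mono)
  then have "range ?r = {..<CARD('n)}"
    by (rule card_subset_eq[rotated]) (use inj in \<open>auto simp: card_image\<close>)
  then show ?thesis using inj by (simp add: bij_betw_def)
qed

text \<open>The parameter \<open>index\<close> ties the locale to the type \<open>'n\<close> of
  matrix indices, which \<open>\<kappa>\<close> does not determine.\<close>

locale block_partition =
  fixes \<kappa> :: "nat \<Rightarrow> nat" and index :: "'n::{finite,linorder} itself"
  assumes partition: "is_partition \<kappa>" and size: "CARD('n) = part_size \<kappa>"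
begin

abbreviation "L \<equiv> part_length \<kappa>"

lemma part_size_eq: "part_size \<kappa> = sum \<kappa> {..<L}"
  unfolding part_size_def partition_support[OF partition] ..

lemma card_less_part_size: "card {q. q < (p :: 'n)} < sum \<kappa> {..<L}"
  using bij_betw_card_less size part_size_eq by (metis UNIV_I bij_betwE lessThan_iff)

text \<open>Replaces \<open>LEAST\<close> by an interval of positions between consecutive partial
  sums: minimality gives the lower end, and positions below the total size ensure that some block
  qualifies.\<close>

lemma block_eq_iff:
  "block \<kappa> (p :: 'n) = i \<longleftrightarrow> card {q. q < p} \<in> {sum \<kappa> {..<i}..<sum \<kappa> {..<Suc i}}"
proof
  let ?r = "card {q. q < p}"
  have ex: "?r < sum \<kappa> {..L}"
    using card_less_part_size[of p] by (rule less_le_trans) (auto intro: sum_mono2)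
  assume i: "block \<kappa> p = i"
  have 1: "?r < sum \<kappa> {..<Suc i}"
    using LeastI[of "\<lambda>i. ?r < sum \<kappa> {..i}", OF ex] i by (simp add: block_def lessThan_Suc_atMost)
  have 2: "sum \<kappa> {..<i} \<le> ?r"
  proof (cases i)
    case (Suc j)
    then have "j < (LEAST i. ?r < sum \<kappa> {..i})" using i by (simp add: block_def)
    then show ?thesis using not_less_Least Suc by (metis leI lessThan_Suc_atMost)
  qed auto
  show "?r \<in> {sum \<kappa> {..<i}..<sum \<kappa> {..<Suc i}}" using 1 2 by simp
next
  let ?r = "card {q. q < p}"
  assume r: "?r \<in> {sum \<kappa> {..<i}..<sum \<kappa> {..<Suc i}}"
  show "block \<kappa> p = i" unfolding block_def
  proof (rule Least_equality)
    show "?r < sum \<kappa> {..i}" using r by (simp add: lessThan_Suc_atMost)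
  next
    fix y assume y: "?r < sum \<kappa> {..y}"
    show "i \<le> y"
    proof (rule ccontr)
      assume "\<not> i \<le> y"
      then have "sum \<kappa> {..y} \<le> sum \<kappa> {..<i}" by (intro sum_mono2) auto
      then show False using r y by auto
    qed
  qed
qed

text \<open>Positions map a block bijectively onto an interval of length \<open>\<kappa> i\<close>.
  For \<open>i\<close> beyond the length both the block and the interval are empty, so no bound on
  \<open>i\<close> is imposed.\<close>

lemma card_block: "card {p :: 'n. block \<kappa> p = i} = \<kappa> i"
proof -
  let ?r = "\<lambda>p :: 'n. card {q. q < p}" and ?I = "{sum \<kappa> {..<i}..<sum \<kappa> {..<Suc i}}"
  have "?I \<subseteq> range ?r"
  proof (cases "i < L")
    case True
    then have "sum \<kappa> {..<Suc i} \<le> sum \<kappa> {..<L}" by (intro sum_mono2) auto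
    then show ?thesis using bij_betw_card_less[where 'n = 'n] size part_size_eq
      by (auto simp: bij_betw_def)
  next
    case False
    then have "\<kappa> i = 0" using partition_support[OF partition] by blast
    then show ?thesis by simp
  qed
  then have "?r ` {p. block \<kappa> p = i} = ?I" unfolding block_eq_iff by auto
  moreover have "inj_on ?r {p. block \<kappa> p = i}"
    using bij_betw_card_less by (auto simp: bij_betw_def intro: inj_on_subset)
  ultimately have "card {p :: 'n. block \<kappa> p = i} = card ?I" by (metis card_image)
  then show ?thesis by simp
qed

lemma \<kappa>_pos_iff: "\<kappa> i > 0 \<longleftrightarrow> i < L"
  using partition_support[OF partition] by auto

lemma block_less: "block \<kappa> (p :: 'n) < L"
proof -
  have "card {q :: 'n. block \<kappa> q = block \<kappa> p} > 0" by (auto simp: card_gt_0_iff)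
  then show ?thesis by (simp add: card_block \<kappa>_pos_iff)
qed

lemma block_surj:
  assumes "i < L"
  obtains p :: 'n where "block \<kappa> p = i"
proof -
  have "card {p :: 'n. block \<kappa> p = i} > 0" by (simp add: card_block \<kappa>_pos_iff assms)
  then show ?thesis using that by (auto simp: card_gt_0_iff)
qed

lemma block_inj:
  assumes "\<forall>i<L. \<kappa> i = 1" "block \<kappa> (p :: 'n) = block \<kappa> q"
  shows "p = q"
proof -
  have "card {r :: 'n. block \<kappa> r = block \<kappa> q} = 1"
    using assms block_less[of q] by (simp add: card_block)
  then show ?thesis using assms by (metis (mono_tags, lifting) card_1_singletonE mem_Collect_eq singletonD)
qed

end

section \<open>Lagrange projectors\<close>

text \<open>If \<open>P\<close> is diagonalizable with eigenvalues \<open>lam 0, \<dots>, lam (n - 1)\<close> and \<open>k < n\<close>, then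
  \<open>lagrange lam k n P\<close> is the projector onto the \<open>k\<close>-th eigenspace.\<close>

primrec lagrange :: "(nat \<Rightarrow> real) \<Rightarrow> nat \<Rightarrow> nat \<Rightarrow> real^'n^'n \<Rightarrow> real^'n^'n" where
  "lagrange lam k 0 P = mat 1"
| "lagrange lam k (Suc n) P = (if n = k then lagrange lam k n P
     else (1 / (lam k - lam n)) *\<^sub>R ((P - lam n *\<^sub>R mat 1) ** lagrange lam k n P))"

lemma Ck_on_lagrange: "Ck_on m UNIV f \<Longrightarrow> Ck_on m UNIV (\<lambda>x. lagrange lam k n (f x))"
proof (induction n)
  case 0
  then show ?case by (simp add: Ck_on_const)
next
  case (Suc n)
  then have "Ck_on m UNIV (\<lambda>x. lagrange lam k n (f x))" by blast
  with Suc.prems have "Ck_on m UNIV (\<lambda>x. (1 / (lam k - lam n)) *\<^sub>R ((f x - lam n *\<^sub>R mat 1) ** lagrange lam k n (f x)))"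
    by (intro Ck_on_intros)
  then show ?case using \<open>Ck_on m UNIV (\<lambda>x. lagrange lam k n (f x))\<close>
    by (cases "n = k") simp_all
qed

text \<open>A polynomial in \<open>P\<close> commutes with conjugation; this is the source of all
  equivariance below.\<close>

lemma lagrange_conj:
  assumes "orthogonal_matrix R"
  shows "lagrange lam k n (R ** P ** transpose R) = R ** lagrange lam k n P ** transpose R"
proof (induction n)
  case 0
  then show ?case using assms by (simp add: orthogonal_matrix_def)
next
  case (Suc n)
  let ?E = "lagrange lam k n P"
  have *: "R ** P ** transpose R - c *\<^sub>R mat 1 = R ** (P - c *\<^sub>R mat 1) ** transpose R" for c
    using assms by (simp add: matrix_ring orthogonal_matrix_def)
  have "(R ** (P - c *\<^sub>R mat 1) ** transpose R) ** (R ** ?E ** transpose R) =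
      R ** ((P - c *\<^sub>R mat 1) ** ?E) ** transpose R" for c
    by (simp add: matrix_mul_assoc orthogonal_matrix_cancel[OF assms])
  then show ?case using Suc
    by (cases "n = k") (simp_all add: * mm.scaleR_left mm.scaleR_right)
qed

lemma lagrange_diag:
  "lagrange lam k n (diag_matrix c) =
     (diag_matrix (\<lambda>p. \<Prod>j\<in>{..<n}-{k}. (c p - lam j) / (lam k - lam j)) :: real^'n^'n)"
proof (induction n)
  case 0
  then show ?case by (simp add: diag_matrix_one)
next
  case (Suc n)
  have 1: "diag_matrix c - a *\<^sub>R mat 1 = (diag_matrix (\<lambda>p. c p - a) :: real^'n^'n)" for a
    by (simp add: vec_eq_iff diag_matrix_nth mat_def)
  have 2: "a *\<^sub>R diag_matrix b = (diag_matrix (\<lambda>p. a * b p) :: real^'n^'n)" for a b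
    by (simp add: vec_eq_iff diag_matrix_nth)
  show ?case
  proof (cases "n = k")
    case True
    then have "{..<Suc n} - {k} = {..<n} - {k}" by auto
    with Suc True show ?thesis by simp
  next
    case False
    then have "{..<Suc n} - {k} = insert n ({..<n} - {k})" by auto
    with Suc False show ?thesis by (simp add: 1 2 diag_matrix_mult)
  qed
qed

text \<open>Existence is enough: in \<open>tangent_space_M\<close> the unknown derivative cancels
  after multiplication by the projector.\<close>

lemma lagrange_has_vector_derivative:
  assumes "(\<gamma> has_vector_derivative v) (at t)"
  shows "\<exists>w. ((\<lambda>t. lagrange lam k n (\<gamma> t)) has_vector_derivative w) (at t)"
proof (induction n)
  case 0
  then show ?case by (auto intro: has_vector_derivative_const)
next
  case (Suc n)
  then obtain w where w: "((\<lambda>t. lagrange lam k n (\<gamma> t)) has_vector_derivative w) (at t)" by blast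
  have "((\<lambda>t. \<gamma> t - lam n *\<^sub>R mat 1) has_vector_derivative v - 0) (at t)"
    by (intro has_vector_derivative_diff has_vector_derivative_const assms)
  from bounded_linear.has_vector_derivative[OF bounded_linear_scaleR_right mm.has_vector_derivative[OF this w]]
  show ?case using w by (cases "n = k") auto
qed

section \<open>The isospectral manifold as an orbit\<close>

locale isospectral_manifold = block_partition \<kappa> index
  for \<kappa> :: "nat \<Rightarrow> nat" and index :: "'n::{finite,linorder} itself" +
  fixes lam :: "nat \<Rightarrow> real"
  assumes inj_lam: "inj_on lam {..<part_length \<kappa>}"
begin

abbreviation M :: "'n square_matrix set" where "M \<equiv> isospectral \<kappa> lam"
abbreviation D :: "'n square_matrix" where "D \<equiv> Delta \<kappa> lam"
abbreviation E :: "nat \<Rightarrow> 'n square_matrix \<Rightarrow> 'n square_matrix" where "E k \<equiv> lagrange lam k L"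

lemma lam_eq_iff: "i < L \<Longrightarrow> j < L \<Longrightarrow> lam i = lam j \<longleftrightarrow> i = j"
  using inj_lam by (auto simp: inj_on_def)

lemma E_Delta:
  assumes "k < L"
  shows "E k D = diag_matrix (\<lambda>p. if block \<kappa> p = k then 1 else 0)"
proof -
  have "(\<Prod>j\<in>{..<L}-{k}. (lam (block \<kappa> p) - lam j) / (lam k - lam j)) = (if block \<kappa> p = k then 1 else 0)"
    for p :: 'n
  proof (cases "block \<kappa> p = k")
    case True
    then show ?thesis using assms by (auto intro!: prod.neutral simp: lam_eq_iff)
  next
    case False
    \<comment> \<open>The index \<open>block \<kappa> p\<close> occurs in the product, and its
      factor is zero.\<close>
    then have "block \<kappa> p \<in> {..<L} - {k}" using block_less[of p] by simp
    then show ?thesis using False by auto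
  qed
  then show ?thesis by (simp add: Delta_def lagrange_diag)
qed

lemma Delta_in_M: "D \<in> M"
proof -
  have "dim {v. D *v v = lam i *\<^sub>R v} = \<kappa> i" if "i < L" for i
  proof -
    \<comment> \<open>Distinctness of the \<open>lam i\<close> makes the eigenspace the coordinate
      subspace of block \<open>i\<close>, whose dimension is the block size.\<close>
    have "{v. D *v v = lam i *\<^sub>R v} = {v. \<forall>p. p \<notin> {p. block \<kappa> p = i} \<longrightarrow> v $ p = 0}"
      using that block_less by (auto simp: vec_eq_iff Delta_def diag_matrix_mult_vec_nth lam_eq_iff)
    then show ?thesis
      using dim_substandard_cart[of "{p :: 'n. block \<kappa> p = i}"] by (simp add: card_block flip: dim_vec_eq)
  qed
  then show ?thesis by (simp add: isospectral_def Delta_def transpose_diag_matrix)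
qed

lemma conj_in_M:
  assumes R: "R \<in> SO" and P: "P \<in> M"
  shows "conj_action R P \<in> M"
proof -
  have "dim {v. conj_action R P *v v = lam i *\<^sub>R v} = \<kappa> i" if "i < L" for i
  proof -
    have inj: "inj ((*v) R)"
      by (rule inj_matrix_vector_mult) (use SO_D[OF R] in \<open>auto simp: invertible_def\<close>)
    have 1: "R *v (transpose R *v v) = v" "transpose R *v (R *v v) = v" for v
      using SO_D[OF R] by (simp_all only: matrix_vector_mul_assoc matrix_vector_mul_lid)
    have 2: "conj_action R P *v v = R *v (P *v (transpose R *v v))" for v
      by (simp only: conj_action_def matrix_vector_mul_assoc matrix_mul_assoc)
    have "{v. conj_action R P *v v = lam i *\<^sub>R v} = (*v) R ` {v. P *v v = lam i *\<^sub>R v}"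
    proof (intro equalityI subsetI)
      fix v assume v: "v \<in> {v. conj_action R P *v v = lam i *\<^sub>R v}"
      then have "transpose R *v (conj_action R P *v v) = lam i *\<^sub>R (transpose R *v v)"
        by (simp only: mem_Collect_eq matrix_vector_mult_scaleR)
      then have "P *v (transpose R *v v) = lam i *\<^sub>R (transpose R *v v)"
        by (simp only: 1 2)
      then show "v \<in> (*v) R ` {v. P *v v = lam i *\<^sub>R v}"
        using 1 by (intro image_eqI[of _ _ "transpose R *v v"]) (simp_all only: mem_Collect_eq)
    next
      fix v assume "v \<in> (*v) R ` {v. P *v v = lam i *\<^sub>R v}"
      then obtain w where "v = R *v w" "P *v w = lam i *\<^sub>R w" by auto
      then show "v \<in> {v. conj_action R P *v v = lam i *\<^sub>R v}"
        by (simp only: mem_Collect_eq 1 2 matrix_vector_mult_scaleR)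
    qed
    then show ?thesis
      using P that inj by (simp add: isospectral_def dim_image_eq inj_on_subset)
  qed
  moreover have "transpose (conj_action R P) = conj_action R P"
    using P by (simp add: conj_action_def isospectral_def matrix_transpose_mul matrix_mul_assoc)
  ultimately show ?thesis by (simp add: isospectral_def)
qed

text \<open>Each eigenspace has an orthonormal basis with as many elements as the corresponding
  block has indices. Labelled by these indices, the bases become the columns of an orthogonal
  matrix; symmetry of \<open>P\<close> gives orthogonality across eigenspaces.\<close>

lemma M_orbit:
  assumes P: "P \<in> M"
  obtains R where "R \<in> SO" "P = conj_action R D"
proof -
  have Pt: "transpose P = P" using P by (simp add: isospectral_def)
  define V where "V i = {v. P *v v = lam i *\<^sub>R v}" for i
  have subsp: "subspace (V i)" for i
    by (auto simp: V_def subspace_def matrix_vector_right_distrib scaleR_add_right matrix_vector_mult_scaleR)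
  have "\<exists>b. (\<forall>p :: 'n. block \<kappa> p = i \<longrightarrow> b p \<in> V i \<and> norm (b p) = 1) \<and>
      (\<forall>p q :: 'n. block \<kappa> p = i \<longrightarrow> block \<kappa> q = i \<longrightarrow> p \<noteq> q \<longrightarrow> orthogonal (b p) (b q))"
    if "i < L" for i
  proof -
    obtain B where B: "B \<subseteq> V i" "pairwise orthogonal B" "\<And>x. x \<in> B \<Longrightarrow> norm x = 1"
      "independent B" "card B = dim (V i)" using orthonormal_basis_subspace[OF subsp] by metis
    have "card {p :: 'n. block \<kappa> p = i} = card B"
      using P that by (simp add: B V_def card_block isospectral_def)
    moreover have "finite B" using B(4) independent_imp_finite by blast
    ultimately obtain b where b: "bij_betw b {p :: 'n. block \<kappa> p = i} B"
      using finite_same_card_bij[of "{p :: 'n. block \<kappa> p = i}" B] by auto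
    then have mem: "b p \<in> B" if "block \<kappa> p = i" for p using that by (auto simp: bij_betw_def)
    have inj: "inj_on b {p :: 'n. block \<kappa> p = i}" using b by (simp add: bij_betw_def)
    have "orthogonal (b p) (b q)" if "block \<kappa> p = i" "block \<kappa> q = i" "p \<noteq> q" for p q
      using B(2) mem inj that unfolding pairwise_def inj_on_def by blast
    then show ?thesis using B(1,3) mem by (intro exI[of _ b]) auto
  qed
  then obtain b where b: "\<And>i p. i < L \<Longrightarrow> block \<kappa> (p :: 'n) = i \<Longrightarrow> b i p \<in> V i \<and> norm (b i p) = 1"
    "\<And>i p q. i < L \<Longrightarrow> block \<kappa> p = i \<Longrightarrow> block \<kappa> q = i \<Longrightarrow> p \<noteq> q \<Longrightarrow> orthogonal (b i p) (b i q)"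
    by metis
  define u where "u p = b (block \<kappa> p) p" for p :: 'n
  have u: "P *v u p = lam (block \<kappa> p) *\<^sub>R u p" "norm (u p) = 1" for p
    using b(1)[OF block_less refl, of p] by (auto simp: u_def V_def)
  have orth: "orthogonal (u p) (u q)" if "p \<noteq> q" for p q
  proof (cases "block \<kappa> p = block \<kappa> q")
    case True
    then show ?thesis using b(2)[OF block_less refl _ that] by (simp add: u_def)
  next
    case False
    have "lam (block \<kappa> p) * (u p \<bullet> u q) = (P *v u p) \<bullet> u q" by (simp add: u)
    also have "\<dots> = u p \<bullet> (P *v u q)"
      by (metis Pt dot_lmul_matrix transpose_matrix_vector)
    also have "\<dots> = lam (block \<kappa> q) * (u p \<bullet> u q)" by (simp add: u)
    finally have "u p \<bullet> u q = 0" using False by (simp add: lam_eq_iff block_less)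
    then show ?thesis by (simp add: orthogonal_def)
  qed
  define R where "R = (\<chi> a p. u p $ a)"
  have col: "column p R = u p" for p by (simp add: column_def R_def vec_eq_iff)
  have R: "orthogonal_matrix R"
    unfolding orthogonal_matrix_orthonormal_columns col using u orth by blast
  have PR: "P ** R = R ** D"
  proof -
    have "(P ** R) $ a $ p = (R ** D) $ a $ p" for a p
    proof -
      have "(P ** R) $ a $ p = (P *v u p) $ a"
        by (simp add: matrix_matrix_mult_def matrix_vector_mult_def R_def)
      also have "\<dots> = (R ** D) $ a $ p"
        by (simp add: u Delta_def diag_matrix_mult_right_nth R_def)
      finally show ?thesis .
    qed
    then show ?thesis by (simp add: vec_eq_iff)
  qed
  obtain S where S: "S \<in> SO" "P ** S = S ** D"
  proof (cases "det R = 1")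
    case True
    then show ?thesis using that[of R] R PR by (simp add: SO_def rotation_matrix_def)
  next
    case False
    then have detR: "det R = -1" using det_orthogonal_matrix[OF R] by blast
    \<comment> \<open>Negating one arbitrary column corrects the determinant, and the eigenvector
      equation survives since the diagonal \<open>F\<close> commutes with \<open>D\<close>.\<close>
    obtain p0 :: 'n where True by blast
    define F where "F = (diag_matrix (\<lambda>p. if p = p0 then -1 else 1) :: 'n square_matrix)"
    have "det F = (\<Prod>p\<in>UNIV. if p = p0 then -1 else 1)"
      unfolding F_def by (subst det_diagonal) (auto simp: diag_matrix_nth)
    then have detF: "det F = -1" by (simp add: prod.delta)
    have "F ** F = diag_matrix (\<lambda>p. 1)"
      unfolding F_def diag_matrix_mult by (rule arg_cong[of _ _ diag_matrix]) auto
    then have "orthogonal_matrix F"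
      by (simp add: orthogonal_matrix F_def transpose_diag_matrix diag_matrix_one)
    then have "R ** F \<in> SO"
      using R detR detF by (simp add: SO_def rotation_matrix_def orthogonal_matrix_mul det_mul)
    moreover have "F ** D = D ** F"
      by (simp add: F_def Delta_def diag_matrix_mult mult.commute)
    then have "P ** (R ** F) = (R ** F) ** D"
      by (metis PR matrix_mul_assoc)
    ultimately show ?thesis using that by blast
  qed
  have "P = conj_action S D"
    using orthogonal_matrix_cancel(4)[OF SO_D(1)[OF S(1)], of P] by (simp add: conj_action_def S(2))
  then show ?thesis using that S by blast
qed

lemma homogeneous: "homogeneous_space SO conj_action M"
proof -
  have "\<exists>g\<in>SO. conj_action g P = Q" if P: "P \<in> M" and Q: "Q \<in> M" for P Q
  proof -
    obtain R where R: "R \<in> SO" "P = conj_action R D" using M_orbit[OF P] by blast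
    obtain S where S: "S \<in> SO" "Q = conj_action S D" using M_orbit[OF Q] by blast
    have "conj_action (S ** transpose R) P = Q"
      unfolding R(2) S(2) conj_action_mult[symmetric]
      by (simp add: orthogonal_matrix_cancel[OF SO_D(1)[OF R(1)]])
    then show ?thesis using R S SO_mult SO_D(6) by blast
  qed
  then show ?thesis
    unfolding homogeneous_space_def
    using Delta_in_M conj_in_M
    by (auto simp: matrix_group_SO compact_SO conj_action_id conj_action_mult smooth_conj_action)
qed

section \<open>The canonical connection\<close>

lemma E_conj: "R \<in> SO \<Longrightarrow> E k (conj_action R P) = conj_action R (E k P)"
  unfolding conj_action_def by (rule lagrange_conj) (rule SO_D)

lemma conj_action_matrix_mult:
  "R \<in> SO \<Longrightarrow> conj_action R A ** conj_action R B = conj_action R (A ** B)"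
  by (simp add: conj_action_def matrix_mul_assoc orthogonal_matrix_cancel[OF SO_D(1)])

text \<open>Each identity is transported from \<open>D\<close>, where the projectors are the
  diagonal indicator matrices of the blocks.\<close>

lemma
  assumes P: "P \<in> M"
  shows E_transpose: "k < L \<Longrightarrow> transpose (E k P) = E k P"
    and E_mult: "i < L \<Longrightarrow> j < L \<Longrightarrow> E i P ** E j P = (if i = j then E i P else 0)"
    and E_sum: "(\<Sum>k<L. E k P) = mat 1"
    and mult_E: "k < L \<Longrightarrow> P ** E k P = lam k *\<^sub>R E k P"
    and E_mult_self: "k < L \<Longrightarrow> E k P ** P = lam k *\<^sub>R E k P"
proof -
  obtain R where R: "R \<in> SO" and PR: "P = conj_action R D" using M_orbit[OF P] by blast
  interpret c: bounded_linear "conj_action R" by (rule bounded_linear_conj_action)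
  show "transpose (E k P) = E k P" if "k < L"
    unfolding PR E_conj[OF R] E_Delta[OF that]
    by (simp add: conj_action_def matrix_transpose_mul transpose_diag_matrix matrix_mul_assoc)
  show "E i P ** E j P = (if i = j then E i P else 0)" if "i < L" "j < L"
  proof -
    have "E i D ** E j D = (if i = j then E i D else 0)"
      using that by (auto simp: E_Delta diag_matrix_mult vec_eq_iff diag_matrix_nth)
    then show ?thesis by (simp add: PR E_conj[OF R] conj_action_matrix_mult[OF R] c.zero)
  qed
  show "(\<Sum>k<L. E k P) = mat 1"
  proof -
    have "(\<Sum>k<L. E k D) = (\<Sum>k<L. diag_matrix (\<lambda>p. if block \<kappa> p = k then 1 else 0))"
      by (simp add: E_Delta)
    also have "\<dots> = mat 1"
      using block_less by (auto simp: vec_eq_iff diag_matrix_nth mat_def)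
    finally have "conj_action R (\<Sum>k<L. E k D) = mat 1"
      using SO_D(3)[OF R] by (simp add: conj_action_def)
    then show ?thesis by (simp add: PR E_conj[OF R] c.sum)
  qed
  have 1: "D ** E k D = lam k *\<^sub>R E k D" "E k D ** D = lam k *\<^sub>R E k D" if "k < L" for k
    unfolding E_Delta[OF that] by (auto simp: Delta_def diag_matrix_mult vec_eq_iff diag_matrix_nth)
  show "P ** E k P = lam k *\<^sub>R E k P" "E k P ** P = lam k *\<^sub>R E k P" if "k < L"
    unfolding PR E_conj[OF R] conj_action_matrix_mult[OF R] 1[OF that] by (simp_all add: c.scaleR)
qed

end

section \<open>Tangent spaces and Lie algebras\<close>

text \<open>Differentiates an identity that holds along whole curves, which yields an equation for
  their velocities.\<close>

lemma has_vector_derivative_eqI: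
  assumes "(f has_vector_derivative v) (at t)" "(g has_vector_derivative w) (at t)" "\<And>t. f t = g t"
  shows "v = w"
  using assms vector_derivative_unique_at by (metis ext)

lemma tangent_spaceI:
  "\<gamma> 0 = x \<Longrightarrow> (\<And>t. \<gamma> t \<in> S) \<Longrightarrow> (\<gamma> has_vector_derivative v) (at 0) \<Longrightarrow> v \<in> tangent_space S x"
  unfolding tangent_space_def by blast

lemma skew_of_curve:
  assumes "\<And>t. \<gamma> t \<in> SO" "\<gamma> 0 = mat 1" "(\<gamma> has_vector_derivative \<xi>) (at 0)"
  shows "transpose \<xi> = - \<xi>"
proof -
  have t: "((\<lambda>t. transpose (\<gamma> t)) has_vector_derivative transpose \<xi>) (at 0)"
    by (rule bounded_linear.has_vector_derivative[OF bounded_linear_transpose assms(3)])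
  have "transpose (\<gamma> 0) ** \<xi> + transpose \<xi> ** \<gamma> 0 = 0"
    by (rule has_vector_derivative_eqI[OF mm.has_vector_derivative[OF t assms(3)] has_vector_derivative_const[of "mat 1"]])
      (use SO_D(2)[OF assms(1)] in simp)
  then show ?thesis by (simp add: assms(2) eq_neg_iff_add_eq_0 add.commute)
qed

text \<open>Both defining equations are differentiated for one inclusion; for the other, the curve
  of \<open>SO_curve\<close> commutes with \<open>P\<close> whenever \<open>\<xi>\<close>
  does.\<close>

lemma lie_algebra_isotropy_SO:
  "lie_algebra (isotropy SO conj_action (P :: real^'n^'n)) = {\<xi>. transpose \<xi> = - \<xi> \<and> \<xi> ** P = P ** \<xi>}"
proof (intro equalityI subsetI)
  fix \<xi> assume "\<xi> \<in> lie_algebra (isotropy SO conj_action P)"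
  then obtain \<gamma> where \<gamma>: "\<gamma> 0 = mat 1" "\<And>t. \<gamma> t \<in> SO" "\<And>t. \<gamma> t ** P = P ** \<gamma> t"
    "(\<gamma> has_vector_derivative \<xi>) (at 0)"
    by (auto simp: lie_algebra_def tangent_space_def isotropy_SO)
  have "\<xi> ** P = P ** \<xi>"
    by (rule has_vector_derivative_eqI[OF bounded_linear.has_vector_derivative[OF mm.bounded_linear_left \<gamma>(4)]
        bounded_linear.has_vector_derivative[OF mm.bounded_linear_right \<gamma>(4)] \<gamma>(3)])
  then show "\<xi> \<in> {\<xi>. transpose \<xi> = - \<xi> \<and> \<xi> ** P = P ** \<xi>}"
    using skew_of_curve[OF \<gamma>(2,1,4)] by simp
next
  fix \<xi> assume "\<xi> \<in> {\<xi>. transpose \<xi> = - \<xi> \<and> \<xi> ** P = P ** \<xi>}"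
  then obtain \<gamma> :: "real \<Rightarrow> real^'n^'n" where "\<gamma> 0 = mat 1" "\<And>t. \<gamma> t \<in> SO"
    "\<And>t. \<gamma> t ** P = P ** \<gamma> t" "(\<gamma> has_vector_derivative \<xi>) (at 0)"
    using SO_curve[of \<xi>] by (metis (mono_tags, lifting) mem_Collect_eq)
  then show "\<xi> \<in> lie_algebra (isotropy SO conj_action P)"
    unfolding lie_algebra_def tangent_space_def isotropy_SO by blast
qed

text \<open>\<open>SO\<close> is the isotropy group of \<open>mat 1\<close>, with which every matrix
  commutes.\<close>

lemma lie_algebra_SO: "lie_algebra SO = {\<xi> :: real^'n^'n. transpose \<xi> = - \<xi>}"
proof -
  have "isotropy SO conj_action (mat 1) = (SO :: (real^'n^'n) set)"
    by (simp add: isotropy_SO)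
  then show ?thesis
    using lie_algebra_isotropy_SO[of "mat 1 :: real^'n^'n"] by simp
qed

context isospectral_manifold
begin

definition canonical_connection :: "'n square_matrix \<Rightarrow> 'n square_matrix \<Rightarrow> 'n square_matrix" where
  \<comment> \<open>the terms with \<open>i = j\<close> vanish since \<open>1 / 0 = 0\<close>\<close>
  "canonical_connection P f = (\<Sum>i<L. \<Sum>j<L. (1 / (lam j - lam i)) *\<^sub>R (E i P ** f ** E j P))"

lemma E_ext:
  assumes P: "P \<in> M" and eq: "\<And>i j. i < L \<Longrightarrow> j < L \<Longrightarrow> E i P ** A ** E j P = E i P ** B ** E j P"
  shows "A = B"
proof -
  have "A = (\<Sum>i<L. \<Sum>j<L. E i P ** A ** E j P)" for A
    using E_sum[OF P] by (simp flip: mm.sum_left mm.sum_right)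
  then show ?thesis using eq by (metis (no_types, lifting) lessThan_iff sum.cong)
qed

text \<open>Orthogonality of the projectors picks one term of the double sum. For
  \<open>i = j\<close> both sides are zero by the convention on division.\<close>

lemma E_canonical_connection:
  assumes P: "P \<in> M" and ij: "i < L" "j < L"
  shows "E i P ** canonical_connection P f ** E j P = (1 / (lam j - lam i)) *\<^sub>R (E i P ** f ** E j P)"
proof -
  have *: "E i P ** (E a P ** f ** E b P) ** E j P =
      (if b = j then if a = i then E i P ** f ** E j P else 0 else 0)" if "a < L" "b < L" for a b
  proof -
    have "E i P ** (E a P ** f ** E b P) ** E j P = (E i P ** E a P) ** f ** (E b P ** E j P)"
      by (simp only: matrix_mul_assoc)
    then show ?thesis using that ij by (simp add: E_mult[OF P] mm.zero_left mm.zero_right)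
  qed
  have "E i P ** canonical_connection P f ** E j P =
      (\<Sum>a<L. \<Sum>b<L. (1 / (lam b - lam a)) *\<^sub>R (E i P ** (E a P ** f ** E b P) ** E j P))"
    by (simp add: canonical_connection_def mm.sum_left mm.sum_right mm.scaleR_left mm.scaleR_right)
  also have "\<dots> = (\<Sum>a<L. \<Sum>b<L. if b = j then if a = i then (1 / (lam j - lam i)) *\<^sub>R (E i P ** f ** E j P) else 0 else 0)"
    by (intro sum.cong refl) (auto simp: *)
  also have "\<dots> = (1 / (lam j - lam i)) *\<^sub>R (E i P ** f ** E j P)"
    using ij by simp
  finally show ?thesis .
qed

lemma E_commutator:
  assumes P: "P \<in> M" and ij: "i < L" "j < L"
  shows "E i P ** (A ** P - P ** A) ** E j P = (lam j - lam i) *\<^sub>R (E i P ** A ** E j P)"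
proof -
  have "E i P ** (A ** P - P ** A) ** E j P = E i P ** A ** (P ** E j P) - (E i P ** P) ** A ** E j P"
    by (simp add: matrix_ring)
  then show ?thesis using ij
    by (simp add: mult_E[OF P] E_mult_self[OF P] mm.scaleR_left mm.scaleR_right scaleR_diff_left)
qed

lemma E_transpose_mid:
  assumes P: "P \<in> M" and ij: "i < L" "j < L"
  shows "E i P ** transpose A ** E j P = transpose (E j P ** A ** E i P)"
  using ij by (simp add: matrix_transpose_mul E_transpose[OF P] matrix_mul_assoc)

text \<open>Transposition exchanges the corners \<open>(i, j)\<close> and \<open>(j, i)\<close>, and
  the divisor \<open>lam j - lam i\<close> changes sign.\<close>

lemma transpose_canonical_connection:
  assumes P: "P \<in> M" and f: "transpose f = f"
  shows "transpose (canonical_connection P f) = - canonical_connection P f"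
proof (rule E_ext[OF P])
  fix i j assume ij: "i < L" "j < L"
  have "E i P ** transpose (canonical_connection P f) ** E j P =
      (1 / (lam i - lam j)) *\<^sub>R transpose (E j P ** f ** E i P)"
    using ij by (simp add: E_transpose_mid[OF P] E_canonical_connection[OF P] transpose_scalar)
  also have "\<dots> = (1 / (lam i - lam j)) *\<^sub>R (E i P ** f ** E j P)"
    using E_transpose_mid[OF P ij, of f] f by simp
  also have "\<dots> = E i P ** (- canonical_connection P f) ** E j P"
    using ij by (simp add: mm.minus_left mm.minus_right E_canonical_connection[OF P] minus_divide_right
        flip: scaleR_minus_left)
  finally show "E i P ** transpose (canonical_connection P f) ** E j P =
      E i P ** (- canonical_connection P f) ** E j P" .
qed

text \<open>With \<open>canonical_connection_commutator\<close>, connection and commutator are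
  mutually inverse on matrices without diagonal corners. By \<open>E_commutator\<close> no
  commutator with \<open>P\<close> has diagonal corners.\<close>

lemma commutator_canonical_connection:
  assumes P: "P \<in> M" and f: "\<And>k. k < L \<Longrightarrow> E k P ** f ** E k P = 0"
  shows "canonical_connection P f ** P - P ** canonical_connection P f = f"
proof (rule E_ext[OF P])
  fix i j assume ij: "i < L" "j < L"
  then show "E i P ** (canonical_connection P f ** P - P ** canonical_connection P f) ** E j P =
      E i P ** f ** E j P"
    using f[of i] by (cases "i = j")
      (simp_all add: E_commutator[OF P] E_canonical_connection[OF P] lam_eq_iff)
qed

lemma E_canonical_connection_diag:
  "P \<in> M \<Longrightarrow> k < L \<Longrightarrow> E k P ** canonical_connection P f ** E k P = 0"
  by (simp add: E_canonical_connection)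

lemma canonical_connection_commutator:
  assumes P: "P \<in> M" and \<xi>: "\<And>k. k < L \<Longrightarrow> E k P ** \<xi> ** E k P = 0"
  shows "canonical_connection P (\<xi> ** P - P ** \<xi>) = \<xi>"
proof (rule E_ext[OF P])
  fix i j assume ij: "i < L" "j < L"
  then show "E i P ** canonical_connection P (\<xi> ** P - P ** \<xi>) ** E j P = E i P ** \<xi> ** E j P"
    using \<xi>[of i] by (cases "i = j")
      (simp_all add: E_commutator[OF P] E_canonical_connection[OF P] lam_eq_iff)
qed

text \<open>The commutator is the velocity of the orbit of \<open>P\<close> under a curve of
  rotations with velocity \<open>\<xi>\<close>.\<close>

lemma commutator_in_tangent_space:
  assumes P: "P \<in> M" and \<xi>: "transpose \<xi> = - \<xi>"
  shows "\<xi> ** P - P ** \<xi> \<in> tangent_space M P"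
proof -
  obtain \<gamma> :: "real \<Rightarrow> 'n square_matrix" where \<gamma>: "\<gamma> 0 = mat 1" "\<And>t. \<gamma> t \<in> SO"
    "(\<gamma> has_vector_derivative \<xi>) (at 0)"
    using SO_curve[OF \<xi>] by metis
  have "((\<lambda>t. \<gamma> t ** P) has_vector_derivative \<xi> ** P) (at 0)"
    by (rule bounded_linear.has_vector_derivative[OF mm.bounded_linear_left \<gamma>(3)])
  from mm.has_vector_derivative[OF this bounded_linear.has_vector_derivative[OF bounded_linear_transpose \<gamma>(3)]]
  have "((\<lambda>t. conj_action (\<gamma> t) P) has_vector_derivative (\<xi> ** P - P ** \<xi>)) (at 0)"
    by (simp add: conj_action_def \<gamma>(1) \<xi> mm.minus_right)
  moreover have "conj_action (\<gamma> 0) P = P" "\<And>t. conj_action (\<gamma> t) P \<in> M"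
    using \<gamma> P conj_in_M by (auto simp: conj_action_id)
  ultimately show ?thesis by (rule tangent_spaceI[of "\<lambda>t. conj_action (\<gamma> t) P", rotated 2])
qed

lemma tangent_space_M:
  assumes P: "P \<in> M"
  shows "tangent_space M P = {f. transpose f = f \<and> (\<forall>k<L. E k P ** f ** E k P = 0)}"
proof (intro equalityI subsetI)
  fix f assume "f \<in> tangent_space M P"
  then obtain \<gamma> where \<gamma>: "\<gamma> 0 = P" "\<And>t. \<gamma> t \<in> M" "(\<gamma> has_vector_derivative f) (at 0)"
    by (auto simp: tangent_space_def)
  have "transpose f = f"
    by (rule has_vector_derivative_eqI[OF
        bounded_linear.has_vector_derivative[OF bounded_linear_transpose \<gamma>(3)] \<gamma>(3)])
      (use \<gamma>(2) in \<open>auto simp: isospectral_def\<close>)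
  moreover have "E k P ** f ** E k P = 0" if k: "k < L" for k
  proof -
    \<comment> \<open>differentiate \<open>(\<gamma> t - lam k) ** E k (\<gamma> t) = 0\<close> and multiply by \<open>E k P\<close> from the left\<close>
    obtain w where w: "((\<lambda>t. E k (\<gamma> t)) has_vector_derivative w) (at 0)"
      using lagrange_has_vector_derivative[OF \<gamma>(3)] by blast
    have "P ** w + f ** E k P = lam k *\<^sub>R w"
      by (rule has_vector_derivative_eqI[OF mm.has_vector_derivative[OF \<gamma>(3) w, unfolded \<gamma>(1)]
          bounded_linear.has_vector_derivative[OF bounded_linear_scaleR_right w]])
        (rule mult_E[OF \<gamma>(2) k])
    then have "E k P ** (P ** w + f ** E k P) = E k P ** (lam k *\<^sub>R w)" by simp
    then show ?thesis
      by (simp add: mm.add_right mm.scaleR_left mm.scaleR_right matrix_mul_assoc E_mult_self[OF P k])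
  qed
  ultimately show "f \<in> {f. transpose f = f \<and> (\<forall>k<L. E k P ** f ** E k P = 0)}" by blast
next
  fix f assume "f \<in> {f. transpose f = f \<and> (\<forall>k<L. E k P ** f ** E k P = 0)}"
  then have f: "transpose f = f" "\<And>k. k < L \<Longrightarrow> E k P ** f ** E k P = 0" by auto
  \<comment> \<open>\<open>f\<close> is the commutator of the skew matrix
    \<open>canonical_connection P f\<close> with \<open>P\<close>, hence a velocity in the
    orbit.\<close>
  show "f \<in> tangent_space M P"
    using commutator_in_tangent_space[OF P transpose_canonical_connection[OF P f(1)]]
    by (simp add: commutator_canonical_connection[OF P f(2)])
qed

lemma canonical_connection_conj:
  assumes R: "R \<in> SO"
  shows "canonical_connection (conj_action R P) (conj_action R f) = conj_action R (canonical_connection P f)"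
proof -
  interpret c: bounded_linear "conj_action R" by (rule bounded_linear_conj_action)
  show ?thesis
    by (simp add: canonical_connection_def E_conj[OF R] conj_action_matrix_mult[OF R] c.sum c.scaleR)
qed

lemma Ck_on_canonical_connection: "Ck_on n UNIV (\<lambda>z. canonical_connection (fst z) (snd z))"
  unfolding canonical_connection_def
  by (intro Ck_on_sum Ck_on_scaleR Ck_on_matrix_mult Ck_on_lagrange Ck_on_bounded_linear
      bounded_linear_fst bounded_linear_snd)

lemma canonical_connection_linear:
  "canonical_connection P (a *\<^sub>R f + b *\<^sub>R g) = a *\<^sub>R canonical_connection P f + b *\<^sub>R canonical_connection P g"
  by (simp add: canonical_connection_def mm.add_left mm.add_right mm.scaleR_left mm.scaleR_right
      scaleR_right_distrib sum.distrib scaleR_sum_right mult.commute)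

lemma is_connection_canonical: "is_connection SO conj_action M canonical_connection"
proof -
  have tan: "transpose f = f" "\<And>k. k < L \<Longrightarrow> E k P ** f ** E k P = 0"
    if "P \<in> M" "f \<in> tangent_space M P" for P f
    using that by (auto simp: tangent_space_M)
  have "smooth_map_on (tangent_bundle M) (\<lambda>(P, f). canonical_connection P f)"
    by (rule smooth_map_onI[OF Ck_on_canonical_connection]) auto
  moreover have "infinitesimal_action conj_action (canonical_connection P f) P = f"
    if "P \<in> M" "f \<in> tangent_space M P" for P f
    using commutator_canonical_connection[OF that(1) tan(2)[OF that]]
      transpose_canonical_connection[OF that(1) tan(1)[OF that]]
    by (simp add: infinitesimal_conj_action mm.minus_right)
  moreover have "canonical_connection (conj_action R P) (tangent_action conj_action R P f) =
      Ad R (canonical_connection P f)" if "R \<in> SO" for R P f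
    using canonical_connection_conj[OF that] SO_D(5)[OF that]
    by (simp add: tangent_action_conj Ad_def conj_action_def)
  ultimately show ?thesis
    using transpose_canonical_connection tan(1) canonical_connection_linear
    by (auto simp: is_connection_def one_form_def lie_algebra_SO)
qed

text \<open>At \<open>D\<close> the corner \<open>E k D ** \<xi> ** E k D\<close> is the k-th
  diagonal block of \<open>\<xi>\<close>, padded with zeros.\<close>

lemma off_diagonal_blocks_eq:
  "off_diagonal_blocks \<kappa> = {\<xi>. transpose \<xi> = - \<xi> \<and> (\<forall>k<L. E k D ** \<xi> ** E k D = 0)}"
proof -
  have "(E k D ** \<xi> ** E k D) $ p $ q = (if block \<kappa> p = k \<and> block \<kappa> q = k then \<xi> $ p $ q else 0)"
    if "k < L" for k p q and \<xi> :: "'n square_matrix"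
    by (simp add: E_Delta[OF that] diag_matrix_mult_right_nth diag_matrix_mult_left_nth)
  then have "(\<forall>k<L. E k D ** \<xi> ** E k D = 0) \<longleftrightarrow>
      (\<forall>k<L. \<forall>p q. block \<kappa> p = k \<and> block \<kappa> q = k \<longrightarrow> \<xi> $ p $ q = 0)"
    for \<xi> :: "'n square_matrix"
    by (simp add: vec_eq_iff)
  then have "(\<forall>k<L. E k D ** \<xi> ** E k D = 0) \<longleftrightarrow> (\<forall>p q. block \<kappa> p = block \<kappa> q \<longrightarrow> \<xi> $ p $ q = 0)"
    for \<xi> :: "'n square_matrix"
    using block_less by metis
  then show ?thesis by (simp add: off_diagonal_blocks_def)
qed

text \<open>Every \<open>\<xi>\<close> on the right is the value at the tangent vector
  \<open>\<xi> ** D - D ** \<xi>\<close>.\<close>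

lemma canonical_connection_image:
  "canonical_connection D ` tangent_space M D = off_diagonal_blocks \<kappa>"
proof (intro equalityI subsetI)
  fix \<xi> assume "\<xi> \<in> canonical_connection D ` tangent_space M D"
  then show "\<xi> \<in> off_diagonal_blocks \<kappa>"
    by (auto simp: off_diagonal_blocks_eq tangent_space_M[OF Delta_in_M]
        transpose_canonical_connection[OF Delta_in_M] E_canonical_connection_diag[OF Delta_in_M])
next
  fix \<xi> :: "'n square_matrix" assume "\<xi> \<in> off_diagonal_blocks \<kappa>"
  then have \<xi>: "transpose \<xi> = - \<xi>" "\<And>k. k < L \<Longrightarrow> E k D ** \<xi> ** E k D = 0"
    by (auto simp: off_diagonal_blocks_eq)
  then show "\<xi> \<in> canonical_connection D ` tangent_space M D"
    using canonical_connection_commutator[OF Delta_in_M \<xi>(2)] commutator_in_tangent_space[OF Delta_in_M \<xi>(1)]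
    by (metis image_eqI)
qed

lemma induces_canonical_connection:
  "induces_connection SO conj_action M D (off_diagonal_blocks \<kappa>) canonical_connection"
  by (simp add: induces_connection_def is_connection_canonical canonical_connection_image)

text \<open>At \<open>D\<close> the value has no diagonal corners and its commutator with
  \<open>D\<close> is \<open>f\<close>, so inverting the commutator determines it. Equivariance
  carries this to every \<open>P\<close> in the orbit.\<close>

lemma induced_connection_unique:
  assumes \<omega>: "induces_connection SO conj_action M D (off_diagonal_blocks \<kappa>) \<omega>"
    and P: "P \<in> M" and f: "f \<in> tangent_space M P"
  shows "\<omega> P f = canonical_connection P f"
proof -
  have at_D: "\<omega> D f = canonical_connection D f" if f: "f \<in> tangent_space M D" for f
  proof -
    have "\<omega> D f \<in> off_diagonal_blocks \<kappa>"
      using \<omega> f by (auto simp: induces_connection_def)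
    then have m: "transpose (\<omega> D f) = - \<omega> D f" "\<And>k. k < L \<Longrightarrow> E k D ** \<omega> D f ** E k D = 0"
      by (auto simp: off_diagonal_blocks_eq)
    have "infinitesimal_action conj_action (\<omega> D f) D = f"
      using \<omega> f Delta_in_M by (simp add: induces_connection_def is_connection_def)
    then have "\<omega> D f ** D - D ** \<omega> D f = f"
      by (simp add: infinitesimal_conj_action m(1) mm.minus_right)
    then show ?thesis using canonical_connection_commutator[OF Delta_in_M m(2)] by simp
  qed
  obtain R where R: "R \<in> SO" and PR: "P = conj_action R D" using M_orbit[OF P] by blast
  define f' where "f' = conj_action (transpose R) f"
  have f_eq: "f = conj_action R f'"
    unfolding f'_def conj_action_mult[symmetric] by (simp add: SO_D(3)[OF R] conj_action_id)
  \<comment> \<open>The curve that represents \<open>f\<close> is rotated back from \<open>P\<close>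
    to \<open>D\<close>.\<close>
  have f': "f' \<in> tangent_space M D"
  proof -
    have D: "D = conj_action (transpose R) P"
      unfolding PR conj_action_mult[symmetric] by (simp add: SO_D(2)[OF R] conj_action_id)
    obtain \<gamma> where \<gamma>: "\<gamma> 0 = P" "\<And>t. \<gamma> t \<in> M" "(\<gamma> has_vector_derivative f) (at 0)"
      using f by (auto simp: tangent_space_def)
    have "((\<lambda>t. conj_action (transpose R) (\<gamma> t)) has_vector_derivative f') (at 0)"
      unfolding f'_def by (rule bounded_linear.has_vector_derivative[OF bounded_linear_conj_action \<gamma>(3)])
    moreover have "conj_action (transpose R) (\<gamma> 0) = D" by (simp add: \<gamma>(1) D)
    moreover have "conj_action (transpose R) (\<gamma> t) \<in> M" for t
      by (rule conj_in_M[OF SO_D(6)[OF R] \<gamma>(2)])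
    ultimately show ?thesis by (rule tangent_spaceI[of "\<lambda>t. conj_action (transpose R) (\<gamma> t)", rotated 2])
  qed
  have "\<omega> (conj_action R D) (tangent_action conj_action R D f') = Ad R (\<omega> D f')"
    using \<omega> R f' Delta_in_M by (simp add: induces_connection_def is_connection_def)
  then have "\<omega> P f = conj_action R (canonical_connection D f')"
    using SO_D(5)[OF R] f_eq at_D[OF f'] PR by (simp add: tangent_action_conj Ad_def conj_action_def)
  also have "\<dots> = canonical_connection P f"
    by (simp only: PR f_eq canonical_connection_conj[OF R])
  finally show ?thesis .
qed

end

section \<open>Flatness, symmetry and the Grassmannian\<close>

text \<open>For \<open>p \<noteq> q\<close> this is the generator of rotations in the coordinate
  plane of \<open>p\<close> and \<open>q\<close>.\<close>

definition elementary_skew :: "'n \<Rightarrow> 'n \<Rightarrow> real^'n^'n" where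
  "elementary_skew p q = (\<chi> a b. if a = p \<and> b = q then 1 else if a = q \<and> b = p then -1 else 0)"

text \<open>The only path from \<open>p\<close> to \<open>q\<close> through both factors passes
  \<open>r\<close>. This entry is the witness against flatness and against symmetry.\<close>

lemma lie_bracket_elementary_skew:
  assumes "p \<noteq> q" "p \<noteq> r" "q \<noteq> r"
  shows "lie_bracket (elementary_skew p r) (elementary_skew r q) $ p $ q = 1"
proof -
  have "elementary_skew p r $ p $ s * elementary_skew r q $ s $ q = (if s = r then 1 else 0)"
    and "elementary_skew r q $ p $ s * elementary_skew p r $ s $ q = 0" for s
    using assms by (auto simp: elementary_skew_def)
  then have "(elementary_skew p r ** elementary_skew r q) $ p $ q = 1"
    and "(elementary_skew r q ** elementary_skew p r) $ p $ q = 0"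
    unfolding matrix_matrix_mult_def by (simp_all only: vec_lambda_beta sum.neutral_const) simp
  then show ?thesis by (simp add: lie_bracket_def)
qed

lemma lie_bracket_skew:
  "transpose \<xi> = - \<xi> \<Longrightarrow> transpose \<eta> = - \<eta> \<Longrightarrow> transpose (lie_bracket \<xi> \<eta>) = - lie_bracket \<xi> \<eta>"
  for \<xi> \<eta> :: "real^'n^'n"
  by (simp add: lie_bracket_def transpose_ring mm.minus_left mm.minus_right)

context block_partition
begin

lemma elementary_skew_off_diagonal:
  fixes p q :: 'n
  assumes "block \<kappa> p \<noteq> block \<kappa> q"
  shows "elementary_skew p q \<in> off_diagonal_blocks \<kappa>"
proof -
  have "p \<noteq> q" using assms by auto
  then have "elementary_skew p q $ b $ a = - elementary_skew p q $ a $ b" for a b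
    by (simp add: elementary_skew_def)
  moreover have "elementary_skew p q $ a $ b = 0" if "block \<kappa> a = block \<kappa> b" for a b
    using assms that by (auto simp: elementary_skew_def)
  ultimately show ?thesis
    unfolding off_diagonal_blocks_def transpose_eq_minus_iff by blast
qed

lemma off_diagonal_bracket_closed_iff:
  assumes "L \<ge> 2"
  shows "(\<forall>\<xi> \<in> off_diagonal_blocks \<kappa>. \<forall>\<eta> \<in> off_diagonal_blocks \<kappa>.
      lie_bracket \<xi> \<eta> \<in> (off_diagonal_blocks \<kappa> :: 'n square_matrix set)) \<longleftrightarrow> (\<forall>i<L. \<kappa> i = 1)"
    (is "?flat \<longleftrightarrow> _")
proof
  assume flat: ?flat
  show "\<forall>i<L. \<kappa> i = 1"
  proof (intro allI impI, rule ccontr)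
    fix i assume i: "i < L" "\<kappa> i \<noteq> 1"
    then have "card {p :: 'n. block \<kappa> p = i} > 1" using \<kappa>_pos_iff[of i] by (simp add: card_block)
    then have "\<not> card {p :: 'n. block \<kappa> p = i} \<le> Suc 0" by simp
    then obtain p q :: 'n where pq: "p \<noteq> q" "block \<kappa> p = i" "block \<kappa> q = i"
      by (auto simp: card_le_Suc0_iff_eq)
    \<comment> \<open>Some block number other than \<open>i\<close>; it is below \<open>L\<close>
      because the length is at least two.\<close>
    define j where "j = (if i = 0 then 1 else 0 :: nat)"
    have "j < L" "j \<noteq> i" using assms by (auto simp: j_def)
    then obtain r :: 'n where r: "block \<kappa> r \<noteq> i" using block_surj[of j] by blast
    have "elementary_skew p r \<in> off_diagonal_blocks \<kappa>" "elementary_skew r q \<in> off_diagonal_blocks \<kappa>"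
      using pq r by (auto intro!: elementary_skew_off_diagonal)
    then have "lie_bracket (elementary_skew p r) (elementary_skew r q) \<in> off_diagonal_blocks \<kappa>"
      using flat by blast
    then have "lie_bracket (elementary_skew p r) (elementary_skew r q) $ p $ q = 0"
      using pq by (simp add: off_diagonal_blocks_def)
    moreover have "lie_bracket (elementary_skew p r) (elementary_skew r q) $ p $ q = 1"
      by (rule lie_bracket_elementary_skew) (use pq r in auto)
    ultimately show False by simp
  qed
next
  assume \<kappa>: "\<forall>i<L. \<kappa> i = 1"
  have "\<xi> $ p $ p = 0" if "transpose \<xi> = - \<xi>" for \<xi> :: "'n square_matrix" and p
  proof -
    have "\<xi> $ p $ p = - \<xi> $ p $ p" using that unfolding transpose_eq_minus_iff by blast
    then show ?thesis by simp
  qed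
  then have "off_diagonal_blocks \<kappa> = {\<xi> :: 'n square_matrix. transpose \<xi> = - \<xi>}"
    using block_inj[OF \<kappa>] by (auto simp: off_diagonal_blocks_def)
  then show ?flat by (simp add: lie_bracket_skew)
qed

end

context isospectral_manifold
begin

lemma commutes_Delta_iff:
  "\<xi> ** D = D ** \<xi> \<longleftrightarrow> (\<forall>p q. block \<kappa> p \<noteq> block \<kappa> q \<longrightarrow> \<xi> $ p $ q = 0)"
proof -
  have "\<xi> ** D = D ** \<xi> \<longleftrightarrow> (\<forall>p q. \<xi> $ p $ q * (lam (block \<kappa> q) - lam (block \<kappa> p)) = 0)"
    by (simp add: vec_eq_iff Delta_def diag_matrix_mult_right_nth diag_matrix_mult_left_nth
        right_diff_distrib mult.commute)
  then show ?thesis by (simp add: lam_eq_iff block_less) metis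
qed

lemma isotropy_algebra_Delta:
  "lie_algebra (isotropy SO conj_action D) =
     {\<xi>. transpose \<xi> = - \<xi> \<and> (\<forall>p q. block \<kappa> p \<noteq> block \<kappa> q \<longrightarrow> \<xi> $ p $ q = 0)}"
  by (simp add: lie_algebra_isotropy_SO commutes_Delta_iff)

text \<open>Indices from three blocks give a bracket with an entry outside the diagonal blocks. With
  two blocks, an intermediate index shares its block with \<open>p\<close> or with \<open>q\<close>,
  so every term of such an entry vanishes.\<close>

lemma off_diagonal_bracket_isotropy_iff:
  assumes "L \<ge> 2"
  shows "(\<forall>\<xi> \<in> off_diagonal_blocks \<kappa>. \<forall>\<eta> \<in> off_diagonal_blocks \<kappa>.
      lie_bracket \<xi> \<eta> \<in> lie_algebra (isotropy SO conj_action D)) \<longleftrightarrow> L = 2" (is "?sym \<longleftrightarrow> _")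
proof
  assume sym: ?sym
  show "L = 2"
  proof (rule ccontr)
    assume "L \<noteq> 2"
    then have L: "0 < L" "1 < L" "2 < L" using assms by auto
    obtain p where p: "block \<kappa> (p :: 'n) = 0" using block_surj[OF L(1)] by blast
    obtain q where q: "block \<kappa> (q :: 'n) = 1" using block_surj[OF L(2)] by blast
    obtain r where r: "block \<kappa> (r :: 'n) = 2" using block_surj[OF L(3)] by blast
    have "elementary_skew p r \<in> off_diagonal_blocks \<kappa>" "elementary_skew r q \<in> off_diagonal_blocks \<kappa>"
      using p q r by (auto intro!: elementary_skew_off_diagonal)
    then have "lie_bracket (elementary_skew p r) (elementary_skew r q) $ p $ q = 0"
      using sym p q unfolding isotropy_algebra_Delta by fastforce
    moreover have "lie_bracket (elementary_skew p r) (elementary_skew r q) $ p $ q = 1"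
      by (rule lie_bracket_elementary_skew) (use p q r in auto)
    ultimately show False by simp
  qed
next
  assume L: "L = 2"
  have "(\<xi> ** \<eta>) $ p $ q = 0"
    if "\<xi> \<in> off_diagonal_blocks \<kappa>" "\<eta> \<in> off_diagonal_blocks \<kappa>" "block \<kappa> p \<noteq> block \<kappa> q"
    for \<xi> \<eta> :: "'n square_matrix" and p q
  proof -
    have "\<xi> $ p $ r * \<eta> $ r $ q = 0" for r
    proof -
      have "block \<kappa> p = block \<kappa> r \<or> block \<kappa> r = block \<kappa> q"
        using that(3) block_less[of p] block_less[of q] block_less[of r] L by linarith
      then show ?thesis using that by (auto simp: off_diagonal_blocks_def)
    qed
    then show ?thesis
      unfolding matrix_matrix_mult_def by (simp only: vec_lambda_beta sum.neutral_const)
  qed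
  then have "lie_bracket \<xi> \<eta> $ p $ q = 0"
    if "\<xi> \<in> off_diagonal_blocks \<kappa>" "\<eta> \<in> off_diagonal_blocks \<kappa>" "block \<kappa> p \<noteq> block \<kappa> q"
    for \<xi> \<eta> :: "'n square_matrix" and p q
    using that by (simp add: lie_bracket_def)
  moreover have "transpose (lie_bracket \<xi> \<eta>) = - lie_bracket \<xi> \<eta>"
    if "\<xi> \<in> off_diagonal_blocks \<kappa>" "\<eta> \<in> off_diagonal_blocks \<kappa>" for \<xi> \<eta> :: "'n square_matrix"
    using that by (simp add: lie_bracket_skew off_diagonal_blocks_def)
  ultimately show ?sym unfolding isotropy_algebra_Delta by blast
qed

lemma reductive: "reductive_structure SO conj_action D (off_diagonal_blocks \<kappa>)"
proof -
  let ?h = "lie_algebra (isotropy SO conj_action D)"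
  have "subspace (off_diagonal_blocks \<kappa> :: 'n square_matrix set)"
    by (auto simp: subspace_def off_diagonal_blocks_def transpose_add transpose_scalar transpose_zero)
  moreover have "?h \<inter> off_diagonal_blocks \<kappa> = {0}"
  proof -
    have "\<xi> $ p $ q = 0" if "\<xi> \<in> ?h" "\<xi> \<in> off_diagonal_blocks \<kappa>" for \<xi> p q
      using that by (cases "block \<kappa> p = block \<kappa> q") (auto simp: isotropy_algebra_Delta off_diagonal_blocks_def)
    then have "?h \<inter> off_diagonal_blocks \<kappa> \<subseteq> {0}" by (auto simp: vec_eq_iff)
    moreover have "0 \<in> ?h" "0 \<in> off_diagonal_blocks \<kappa>"
      by (auto simp: isotropy_algebra_Delta off_diagonal_blocks_def transpose_zero)
    ultimately show ?thesis by auto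
  qed
  moreover have "{\<xi> + \<eta> |\<xi> \<eta>. \<xi> \<in> ?h \<and> \<eta> \<in> off_diagonal_blocks \<kappa>} = lie_algebra SO"
  proof (intro equalityI subsetI)
    fix \<zeta> assume "\<zeta> \<in> {\<xi> + \<eta> |\<xi> \<eta>. \<xi> \<in> ?h \<and> \<eta> \<in> off_diagonal_blocks \<kappa>}"
    then show "\<zeta> \<in> lie_algebra SO"
      by (auto simp: isotropy_algebra_Delta off_diagonal_blocks_def lie_algebra_SO transpose_add)
  next
    fix \<zeta> :: "'n square_matrix" assume "\<zeta> \<in> lie_algebra SO"
    then have \<zeta>: "\<zeta> $ q $ p = - \<zeta> $ p $ q" for p q
      unfolding lie_algebra_SO transpose_eq_minus_iff by blast
    define \<xi> \<eta> :: "'n square_matrix"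
      where "\<xi> = (\<chi> p q. if block \<kappa> p = block \<kappa> q then \<zeta> $ p $ q else 0)"
        and "\<eta> = (\<chi> p q. if block \<kappa> p = block \<kappa> q then 0 else \<zeta> $ p $ q)"
    have "\<zeta> = \<xi> + \<eta>" by (simp add: vec_eq_iff \<xi>_def \<eta>_def)
    moreover have "\<xi> \<in> ?h"
      by (auto simp: isotropy_algebra_Delta transpose_eq_minus_iff \<xi>_def intro: \<zeta>)
    moreover have "\<eta> \<in> off_diagonal_blocks \<kappa>"
      by (auto simp: off_diagonal_blocks_def transpose_eq_minus_iff \<eta>_def intro: \<zeta>)
    ultimately show "\<zeta> \<in> {\<xi> + \<eta> |\<xi> \<eta>. \<xi> \<in> ?h \<and> \<eta> \<in> off_diagonal_blocks \<kappa>}" by blast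
  qed
  moreover have "Ad R \<xi> \<in> off_diagonal_blocks \<kappa>"
    if "R \<in> isotropy SO conj_action D" "\<xi> \<in> off_diagonal_blocks \<kappa>" for R \<xi>
  proof -
    have R: "R \<in> SO" "conj_action R D = D" using that by (auto simp: isotropy_def)
    have \<xi>: "transpose \<xi> = - \<xi>" "\<And>k. k < L \<Longrightarrow> E k D ** \<xi> ** E k D = 0"
      using that by (auto simp: off_diagonal_blocks_eq)
    \<comment> \<open>A rotation fixing \<open>D\<close> also fixes the polynomial
      \<open>E k D\<close>, so it conjugates corners to corners.\<close>
    have "E k D ** conj_action R \<xi> ** E k D = conj_action R (E k D ** \<xi> ** E k D)" for k
      using E_conj[OF R(1), of k D] R(2) by (metis conj_action_matrix_mult[OF R(1)])
    then have "E k D ** conj_action R \<xi> ** E k D = 0" if "k < L" for k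
      using \<xi>(2)[OF that] by (simp add: conj_action_def mm.zero_left mm.zero_right)
    moreover have "transpose (conj_action R \<xi>) = - conj_action R \<xi>"
      by (simp add: conj_action_def matrix_transpose_mul \<xi>(1) mm.minus_left mm.minus_right matrix_mul_assoc)
    moreover have "Ad R \<xi> = conj_action R \<xi>" by (simp add: Ad_def conj_action_def SO_D(5)[OF R(1)])
    ultimately show ?thesis by (simp add: off_diagonal_blocks_eq)
  qed
  ultimately show ?thesis by (simp add: reductive_structure_def)
qed

section \<open>Isotropy groups when all multiplicities are one\<close>

lemma isotropy_Delta_diagonal:
  assumes "\<forall>i<L. \<kappa> i = 1"
  shows "isotropy SO conj_action D = {R \<in> SO. \<exists>\<epsilon>. range \<epsilon> \<subseteq> {-1, 1} \<and> R = diag_matrix \<epsilon>}"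
proof (intro equalityI subsetI)
  fix R assume "R \<in> isotropy SO conj_action D"
  then have R: "R \<in> SO" "R ** D = D ** R" by (auto simp: isotropy_SO)
  define \<epsilon> where "\<epsilon> p = R $ p $ p" for p
  have "R $ p $ q = 0" if "p \<noteq> q" for p q
    using R(2) block_inj[OF assms, of p q] that unfolding commutes_Delta_iff by blast
  then have R_eq: "R = diag_matrix \<epsilon>" by (auto simp: vec_eq_iff diag_matrix_nth \<epsilon>_def)
  have "\<epsilon> p \<in> {-1, 1}" for p
  proof -
    have "diag_matrix (\<lambda>p. \<epsilon> p * \<epsilon> p) = (mat 1 :: 'n square_matrix)"
      using SO_D(2)[OF R(1)] by (simp add: R_eq transpose_diag_matrix diag_matrix_mult)
    then have "diag_matrix (\<lambda>p. \<epsilon> p * \<epsilon> p) $ p $ p = (mat 1 :: 'n square_matrix) $ p $ p" by simp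
    then have "\<epsilon> p * \<epsilon> p = 1" by (simp add: diag_matrix_nth mat_def)
    then show ?thesis by (auto simp: square_eq_1_iff)
  qed
  then have "range \<epsilon> \<subseteq> {-1, 1}" by blast
  then show "R \<in> {R \<in> SO. \<exists>\<epsilon>. range \<epsilon> \<subseteq> {-1, 1} \<and> R = diag_matrix \<epsilon>}"
    using R(1) R_eq by blast
next
  fix R :: "'n square_matrix"
  assume "R \<in> {R \<in> SO. \<exists>\<epsilon>. range \<epsilon> \<subseteq> {-1, 1} \<and> R = diag_matrix \<epsilon>}"
  then show "R \<in> isotropy SO conj_action D"
    by (auto simp: isotropy_SO Delta_def diag_matrix_mult mult.commute)
qed

text \<open>The sign matrices fixing \<open>D\<close> are finite in number, isotropy groups at other
  points are conjugate to this one, and finite sets are discrete.\<close>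

lemma locally_principal:
  assumes "\<forall>i<L. \<kappa> i = 1"
  shows "locally_principal_homogeneous_space SO conj_action M"
proof -
  have "finite {\<epsilon> :: 'n \<Rightarrow> real. range \<epsilon> \<subseteq> {-1, 1}}"
    using finite_set_of_finite_funs[of "UNIV :: 'n set" "{-1, 1 :: real}"]
    by (simp add: image_subset_iff)
  moreover have "isotropy SO conj_action D \<subseteq> diag_matrix ` {\<epsilon>. range \<epsilon> \<subseteq> {-1, 1}}"
    using isotropy_Delta_diagonal[OF assms] by blast
  ultimately have fin: "finite (isotropy SO conj_action D)"
    by (meson finite_imageI finite_subset)
  have "finite (isotropy SO conj_action P)" if P: "P \<in> M" for P
  proof -
    obtain R where R: "R \<in> SO" "P = conj_action R D" using M_orbit[OF P] by blast
    have "S \<in> (\<lambda>T. R ** T ** transpose R) ` isotropy SO conj_action D"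
      if "S \<in> isotropy SO conj_action P" for S
    proof (rule image_eqI)
      have S: "S \<in> SO" "conj_action S P = P" using that by (auto simp: isotropy_def)
      show "S = R ** (transpose R ** S ** R) ** transpose R"
        by (simp add: matrix_mul_assoc orthogonal_matrix_cancel[OF SO_D(1)[OF R(1)]])
      have "conj_action (transpose R ** S ** R) D = conj_action (transpose R) P"
        using S(2) by (simp add: conj_action_mult R(2))
      also have "\<dots> = D"
        unfolding R(2) conj_action_mult[symmetric] by (simp add: SO_D(2)[OF R(1)] conj_action_id)
      finally show "transpose R ** S ** R \<in> isotropy SO conj_action D"
        using R(1) S(1) by (simp add: isotropy_def SO_mult SO_D(6))
    qed
    then show ?thesis using fin by (meson finite_imageI finite_subset subsetI)
  qed
  then show ?thesis
    using homogeneous discrete_compact_finite_iff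
    by (auto simp: locally_principal_homogeneous_space_def)
qed

section \<open>Two eigenvalues: the explicit connection and the Grassmannian\<close>

lemma canonical_connection_two_eigenvalues:
  assumes L: "L = 2" and P: "P \<in> M" and f: "f \<in> tangent_space M P"
  shows "canonical_connection P f = (1 / (lam 0 - lam 1)\<^sup>2) *\<^sub>R (f ** P - P ** f)"
proof (rule E_ext[OF P])
  fix i j assume ij: "i < L" "j < L"
  \<comment> \<open>For \<open>i = j\<close> both sides of the quotient identity below are zero;
    otherwise it is \<open>1 / x = x / x^2\<close>.\<close>
  have "i = j \<or> (lam 0 - lam 1)\<^sup>2 = (lam j - lam i)\<^sup>2"
    using ij L by (auto simp: less_2_cases_iff power2_commute)
  then have "1 / (lam j - lam i) = (lam j - lam i) / (lam 0 - lam 1)\<^sup>2"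
    by (auto simp: power2_eq_square)
  then show "E i P ** canonical_connection P f ** E j P =
      E i P ** ((1 / (lam 0 - lam 1)\<^sup>2) *\<^sub>R (f ** P - P ** f)) ** E j P"
    using ij by (simp add: E_canonical_connection[OF P] E_commutator[OF P] mm.scaleR_left mm.scaleR_right)
qed

lemma isomorphic_grassmannian:
  assumes L: "L = 2"
  shows "isomorphic_G_spaces SO conj_action M conj_action (grassmannian (\<kappa> 0) :: 'n square_matrix set)"
proof -
  let ?d = "lam 0 - lam 1" and ?G = "grassmannian (\<kappa> 0) :: 'n square_matrix set"
  have d: "?d \<noteq> 0" using lam_eq_iff[of 0 1] L by simp
  \<comment> \<open>The affine map sending the eigenvalues \<open>lam 0\<close>,
    \<open>lam 1\<close> to 1, 0. Its inverse \<open>\<psi>\<close> is affine too, so both are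
    smooth.\<close>
  define \<phi> where "\<phi> P = (1 / ?d) *\<^sub>R (P - lam 1 *\<^sub>R mat 1)" for P :: "'n square_matrix"
  define \<psi> where "\<psi> Q = lam 1 *\<^sub>R mat 1 + ?d *\<^sub>R Q" for Q :: "'n square_matrix"
  have inv: "\<psi> (\<phi> P) = P" "\<phi> (\<psi> P) = P" for P using d by (auto simp: \<phi>_def \<psi>_def)
  \<comment> \<open>For length two the Lagrange polynomial has a single factor, so idempotence,
    symmetry and equivariance are inherited from the projectors.\<close>
  have \<phi>_E: "\<phi> P = E 0 P" for P using L by (simp add: \<phi>_def numeral_2_eq_2)
  have range_proj: "range ((*v) Q) = {v. Q *v v = v}" if "Q ** Q = Q" for Q :: "'n square_matrix"
    using that by (auto simp: matrix_vector_mul_assoc) (metis rangeI)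
  have \<psi>_mult: "\<psi> Q *v v = lam 1 *\<^sub>R v + ?d *\<^sub>R (Q *v v)" for Q v
    by (simp add: \<psi>_def matrix_vector_mult_add_rdistrib flip: scaleR_matrix_vector_assoc)
  have eig0: "{v. \<psi> Q *v v = lam 0 *\<^sub>R v} = {v. Q *v v = v}" for Q
  proof -
    have "\<psi> Q *v v = lam 0 *\<^sub>R v \<longleftrightarrow> ?d *\<^sub>R (Q *v v) = ?d *\<^sub>R v" for v
      by (auto simp: \<psi>_mult algebra_simps)
    then show ?thesis using d by simp
  qed
  have eig1: "{v. \<psi> Q *v v = lam 1 *\<^sub>R v} = {v. Q *v v = 0}" for Q
    using d by (simp add: \<psi>_mult)
  have to: "\<phi> P \<in> ?G" if P: "P \<in> M" for P
  proof -
    have idem: "\<phi> P ** \<phi> P = \<phi> P" "transpose (\<phi> P) = \<phi> P"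
      using E_mult[OF P, of 0 0] E_transpose[OF P, of 0] L pos2 by (simp_all only: \<phi>_E simp_thms if_True)
    have "rank (\<phi> P) = dim {v. \<psi> (\<phi> P) *v v = lam 0 *\<^sub>R v}"
      by (simp add: rank_dim_range range_proj[OF idem(1)] eig0)
    then show ?thesis using P L idem by (simp add: grassmannian_def isospectral_def inv)
  qed
  have from_G: "\<psi> Q \<in> M" if "Q \<in> ?G" for Q
  proof -
    have Q: "transpose Q = Q" "Q ** Q = Q" "rank Q = \<kappa> 0" using that by (auto simp: grassmannian_def)
    have dim0: "dim {v. Q *v v = v} = \<kappa> 0"
      using Q(3) by (simp add: rank_dim_range range_proj[OF Q(2)])
    have size2: "CARD('n) = \<kappa> 0 + \<kappa> 1"
      using size part_size_eq L by (simp add: numeral_2_eq_2)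
    \<comment> \<open>By symmetry of \<open>Q\<close> its kernel is the orthogonal complement of its
      range, which gives the second multiplicity.\<close>
    have "{v. Q *v v = 0} = {v. \<forall>w\<in>range ((*v) Q). orthogonal v w}"
    proof -
      have "v \<bullet> (Q *v w) = (Q *v v) \<bullet> w" for v w
        using dot_lmul_matrix[of v Q w] Q(1) by (metis transpose_matrix_vector)
      then show ?thesis by (auto simp: orthogonal_def)
    qed
    then have "dim {v. Q *v v = 0} + dim (range ((*v) Q)) = CARD('n)"
      using dim_subspace_orthogonal_to_vectors[of "range ((*v) Q)" UNIV]
      by (simp add: linear_subspace_image orthogonal_commute)
    then have dim1: "dim {v. Q *v v = 0} = \<kappa> 1"
      using Q(3) size2 by (simp add: rank_dim_range)
    have "dim {v. \<psi> Q *v v = lam i *\<^sub>R v} = \<kappa> i" if "i < L" for i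
      using that L dim0 dim1 eig0[of Q] eig1[of Q] by (auto simp: less_2_cases_iff)
    moreover have "transpose (\<psi> Q) = \<psi> Q" by (simp add: \<psi>_def transpose_ring Q)
    ultimately show ?thesis by (simp add: isospectral_def)
  qed
  have bij: "bij_betw \<phi> M ?G"
    by (rule bij_betw_byWitness[where f' = \<psi>]) (use inv to from_G in auto)
  have "smooth_map_on M \<phi>"
  proof (rule smooth_map_onI[where F = \<phi>])
    show "Ck_on n UNIV \<phi>" for n
      unfolding \<phi>_def by (intro Ck_on_scaleR Ck_on_diff Ck_on_const Ck_on_bounded_linear bounded_linear_ident)
  qed simp
  moreover have "smooth_map_on ?G (inv_into M \<phi>)"
  proof (rule smooth_map_onI[where F = \<psi>])
    show "Ck_on n UNIV \<psi>" for n
      unfolding \<psi>_def by (intro Ck_on_scaleR Ck_on_add Ck_on_const Ck_on_bounded_linear bounded_linear_ident)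
    show "\<psi> Q = inv_into M \<phi> Q" if "Q \<in> ?G" for Q
      using inv_into_f_f[OF bij_betw_imp_inj_on[OF bij] from_G[OF that]] by (simp add: inv)
  qed
  moreover have "\<phi> (conj_action R P) = conj_action R (\<phi> P)" if "R \<in> SO" for R P
    by (simp add: \<phi>_E E_conj[OF that])
  ultimately show ?thesis using bij unfolding isomorphic_G_spaces_def by blast
qed

end

text \<open>The principal case is stated as discreteness of the isotropy groups, with the group at
  \<open>\<Delta>\<close> made explicit, because \<open>isotropy_Delta_nontrivial\<close> rules out
  trivial ones in dimension at least two.\<close>

theorem proposition5p5:
  fixes \<kappa> :: "nat \<Rightarrow> nat" and lam :: "nat \<Rightarrow> real"
    and M \<mm> :: "('n::{finite,linorder}) square_matrix set" and \<Delta> :: "'n square_matrix"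
  assumes "is_partition \<kappa>"
    and "part_length \<kappa> \<ge> 2"
    and "CARD('n) = part_size \<kappa>"
    and "inj_on lam {..<part_length \<kappa>}"
    and "M = isospectral \<kappa> lam"
    and "\<Delta> = Delta \<kappa> lam"
    and "\<mm> = off_diagonal_blocks \<kappa>"
  shows "homogeneous_space SO conj_action M \<and> \<Delta> \<in> M \<and>
    reductive_structure SO conj_action \<Delta> \<mm> \<and>
    (\<exists>\<omega>. induces_connection SO conj_action M \<Delta> \<mm> \<omega>) \<and>
    (\<forall>\<omega>. induces_connection SO conj_action M \<Delta> \<mm> \<omega> \<longrightarrow>
       (flat_connection M \<Delta> \<omega> \<longleftrightarrow> (\<forall>i < part_length \<kappa>. \<kappa> i = 1)) \<and>
       (symmetric_connection SO conj_action M \<Delta> \<omega> \<longleftrightarrow> part_length \<kappa> = 2) \<and>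
       (part_length \<kappa> = 2 \<longrightarrow>
          (\<forall>P\<in>M. \<forall>\<delta>P\<in>tangent_space M P.
             \<omega> P \<delta>P = (1 / (lam 0 - lam 1)\<^sup>2) *\<^sub>R (\<delta>P ** P - P ** \<delta>P)))) \<and>
    ((\<forall>i < part_length \<kappa>. \<kappa> i = 1) \<longrightarrow>
       locally_principal_homogeneous_space SO conj_action M \<and>
       isotropy SO conj_action \<Delta> = {R \<in> SO. \<exists>\<epsilon>. range \<epsilon> \<subseteq> {-1, 1} \<and> R = diag_matrix \<epsilon>}) \<and>
    (part_length \<kappa> = 2 \<longrightarrow>
       isomorphic_G_spaces SO conj_action M conj_action (grassmannian (\<kappa> 0)))"
proof -
  interpret isospectral_manifold \<kappa> "TYPE('n)" lam
    using assms(1,3,4) by unfold_locales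
  have eqs: "M = isospectral \<kappa> lam" "\<Delta> = D" "\<mm> = off_diagonal_blocks \<kappa>"
    using assms(5-7) by simp_all
  have "(flat_connection M \<Delta> \<omega> \<longleftrightarrow> (\<forall>i<L. \<kappa> i = 1)) \<and>
      (symmetric_connection SO conj_action M \<Delta> \<omega> \<longleftrightarrow> L = 2) \<and>
      (L = 2 \<longrightarrow> (\<forall>P\<in>M. \<forall>\<delta>P\<in>tangent_space M P.
         \<omega> P \<delta>P = (1 / (lam 0 - lam 1)\<^sup>2) *\<^sub>R (\<delta>P ** P - P ** \<delta>P)))"
    if \<omega>: "induces_connection SO conj_action M \<Delta> \<mm> \<omega>" for \<omega>
  proof (intro conjI impI ballI)
    \<comment> \<open>Flatness and symmetry depend on \<open>\<omega>\<close> through this image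
      only, so both become bracket conditions on
      \<open>off_diagonal_blocks \<kappa>\<close>.\<close>
    have image: "\<omega> \<Delta> ` tangent_space M \<Delta> = off_diagonal_blocks \<kappa>"
      using \<omega> by (simp only: induces_connection_def eqs)
    show "flat_connection M \<Delta> \<omega> \<longleftrightarrow> (\<forall>i<L. \<kappa> i = 1)"
      unfolding flat_connection_def Let_def image by (rule off_diagonal_bracket_closed_iff[OF assms(2)])
    show "symmetric_connection SO conj_action M \<Delta> \<omega> \<longleftrightarrow> L = 2"
      unfolding symmetric_connection_def Let_def image unfolding eqs(2)
      by (rule off_diagonal_bracket_isotropy_iff[OF assms(2)])
    show "\<omega> P \<delta>P = (1 / (lam 0 - lam 1)\<^sup>2) *\<^sub>R (\<delta>P ** P - P ** \<delta>P)"
      if "L = 2" "P \<in> M" "\<delta>P \<in> tangent_space M P" for P \<delta>P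
      using induced_connection_unique[OF \<omega>[unfolded eqs]] canonical_connection_two_eigenvalues that
      unfolding eqs by simp
  qed
  then show ?thesis
    using homogeneous Delta_in_M reductive induces_canonical_connection locally_principal
      isotropy_Delta_diagonal isomorphic_grassmannian
    unfolding eqs by blast
qed

end
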